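(* Let $\mathcal{A}$ be a semiprime, complex, unital Banach algebra with $\mathrm{soc}(\mathcal{A})\neq\{0\}$, let $x\in\mathcal{A}$, and let $\Omega$ be a connected component of $\rho_{BF}(x)$. Then the following alternative holds (one of the two cases occurs): (1) $x$ has the right SVEP at every point of $\Omega$. In this case, $q_l(x-\lambda)<\infty$ for all $\lambda\in\Omega$. Moreover, $\sigma_r(x)$ does not have limit points in $\Omega$, and $x-\lambda$ is not a right topological divisor of zero for every point $\lambda\in\Omega$, except at most countably many isolated points in $\Omega$. (2) $x$ has the right SVEP at no point of $\Omega$. In this case, $q_l(x-\lambda)=\infty$ for all $\lambda\in\Omega$, and $x-\lambda$ is a right topological divisor of zero for every point $\lambda\in\Omega$.
   Context: An algebra is semiprime if $\{0\}$ is its only two-sided ideal $J$ with $J^2=\{0\}$. $\mathrm{soc}(\mathcal{A})$ is the sum of all minimal right ideals of $\mathcal{A}$ (equal to the sum of all minimal left ideals), or $\{0\}$ if there are none. An element $a$ of a ring is Drazin invertible if there are $b$ in the ring and $k\in\mathbb{N}$ with $bab=b$, $ab=ba$, $a^kba=a^k$. An element $a\in\mathcal{A}$ is B-Fredholm if its image in $\mathcal{A}/\mathrm{soc}(\mathcal{A})$ is Drazin invertible. $x-\lambda$ means $x-\lambda1$. $\sigma_{BF}(x)=\{\lambda\in\mathbb{C}:x-\lambda\text{ is not B-Fredholm}\}$ and $\rho_{BF}(x)=\mathbb{C}\setminus\sigma_{BF}(x)$. $x$ has right SVEP at $\lambda\in\mathbb{C}$ if for every connected open neighbourhood $U$ of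 $\lambda$ the only holomorphic $f:U\to\mathcal{A}$ with $f(\mu)(\mu-x)=0$ for all $\mu\in U$ is $f\equiv0$. $q_l(x)=\inf\{n\ge0:x^n\mathcal{A}=x^{n+1}\mathcal{A}\}$ (with $\inf\emptyset=\infty$). $\sigma_r(x)=\{\lambda\in\mathbb{C}:x-\lambda\text{ is not right invertible}\}$. An element $a\in\mathcal{A}$ is a right topological divisor of zero if there is a sequence $(a_n)$ in $\mathcal{A}$ with $\|a_n\|=1$ for all $n$ and $a_na\to0$. *)

theory Defs
  imports "HOL-Analysis.Analysis" "HOL-Algebra.QuotRing" "HOL-Algebra.Ideal_Product"
begin

section \<open>Complex unital Banach algebras\<close>

text \<open>
  The norm is complete and submultiplicative, and \<open>norm 1 = 1\<close> is not required, only \<open>1 \<noteq> 0\<close>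
  (part of \<^class>\<open>ring_1\<close>). The real scaling needed by the norm classes is the restriction
  of the complex one.
\<close>

class complex_unital_banach_algebra = real_normed_algebra + ring_1 + banach +
  fixes scaleC :: "complex \<Rightarrow> 'a \<Rightarrow> 'a"
  assumes scaleC_add_right: "scaleC c (x + y) = scaleC c x + scaleC c y"
    and scaleC_add_left: "scaleC (c + d) x = scaleC c x + scaleC d x"
    and scaleC_scaleC: "scaleC c (scaleC d x) = scaleC (c * d) x"
    and scaleC_one: "scaleC 1 x = x"
    and scaleR_eq_scaleC: "scaleR r x = scaleC (complex_of_real r) x"
    and scaleC_mult_left: "scaleC c x * y = scaleC c (x * y)"
    and scaleC_mult_right: "x * scaleC c y = scaleC c (x * y)"
    and norm_scaleC: "norm (scaleC c x) = cmod c * norm x"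

abbreviation shift :: "'a::complex_unital_banach_algebra \<Rightarrow> complex \<Rightarrow> 'a" where
  "shift x z \<equiv> x - scaleC z 1"

section \<open>Ideals and the socle\<close>

text \<open>
  In a unital algebra every one-sided or two-sided ring ideal is a linear subspace, because
  \<open>c a = (c 1) a = a (c 1)\<close>; hence ring ideals are the same as algebra ideals.
\<close>

definition ring_of_type :: "'a::ring_1 itself \<Rightarrow> 'a ring" where
  "ring_of_type _ = \<lparr>carrier = UNIV, mult = (*), one = 1, zero = 0, add = (+)\<rparr>"

definition semiprime :: "'a::ring_1 itself \<Rightarrow> bool" where
  "semiprime T \<longleftrightarrow>
     (\<forall>J. ideal J (ring_of_type T) \<longrightarrow> J \<cdot>\<^bsub>ring_of_type T\<^esub> J = {0} \<longrightarrow> J = {0})"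

definition right_ideal :: "'a::ring_1 set \<Rightarrow> bool" where
  "right_ideal J \<longleftrightarrow>
     additive_subgroup J (ring_of_type TYPE('a)) \<and> (\<forall>j\<in>J. \<forall>a. j * a \<in> J)"

definition minimal_right_ideal :: "'a::ring_1 set \<Rightarrow> bool" where
  "minimal_right_ideal J \<longleftrightarrow>
     right_ideal J \<and> J \<noteq> {0} \<and> (\<forall>K. right_ideal K \<longrightarrow> K \<subseteq> J \<longrightarrow> K = {0} \<or> K = J)"

text \<open>
  The sum of all minimal right ideals; the choice \<open>\<F> = {}\<close> gives \<open>0\<close>, so the socle is \<open>{0}\<close>
  if there are none.
\<close>

definition socle :: "'a::ring_1 set" where
  "socle = {(\<Sum>J\<in>\<F>. s J) |\<F> s. finite \<F> \<and> (\<forall>J\<in>\<F>. minimal_right_ideal J \<and> s J \<in> J)}"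

section \<open>Drazin invertibility and B-Fredholm elements\<close>

definition drazin_invertible :: "('r, 'm) ring_scheme \<Rightarrow> 'r \<Rightarrow> bool" where
  "drazin_invertible R a \<longleftrightarrow>
     (\<exists>b\<in>carrier R. \<exists>k::nat.
        b \<otimes>\<^bsub>R\<^esub> a \<otimes>\<^bsub>R\<^esub> b = b \<and> a \<otimes>\<^bsub>R\<^esub> b = b \<otimes>\<^bsub>R\<^esub> a \<and>
        a [^]\<^bsub>R\<^esub> k \<otimes>\<^bsub>R\<^esub> b \<otimes>\<^bsub>R\<^esub> a = a [^]\<^bsub>R\<^esub> k)"

definition B_Fredholm :: "'a::ring_1 \<Rightarrow> bool" where
  "B_Fredholm a \<longleftrightarrow>
     drazin_invertible (ring_of_type TYPE('a) Quot socle) (socle +>\<^bsub>ring_of_type TYPE('a)\<^esub> a)"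

definition sigma_BF :: "'a::complex_unital_banach_algebra \<Rightarrow> complex set" where
  "sigma_BF x = {z. \<not> B_Fredholm (shift x z)}"

definition rho_BF :: "'a::complex_unital_banach_algebra \<Rightarrow> complex set" where
  "rho_BF x = - sigma_BF x"

section \<open>Local spectral theory\<close>

definition right_invertible :: "'a::ring_1 \<Rightarrow> bool" where
  "right_invertible a \<longleftrightarrow> (\<exists>b. a * b = 1)"

definition sigma_r :: "'a::complex_unital_banach_algebra \<Rightarrow> complex set" where
  "sigma_r x = {z. \<not> right_invertible (shift x z)}"

definition algebra_holomorphic_on ::
    "(complex \<Rightarrow> 'a::complex_unital_banach_algebra) \<Rightarrow> complex set \<Rightarrow> bool" where
  "algebra_holomorphic_on f U \<longleftrightarrow>
     (\<forall>z\<in>U. \<exists>D. (f has_derivative (\<lambda>h. scaleC h D)) (at z within U))"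

definition right_SVEP_at :: "'a::complex_unital_banach_algebra \<Rightarrow> complex \<Rightarrow> bool" where
  "right_SVEP_at x z \<longleftrightarrow>
     (\<forall>U f. open U \<and> connected U \<and> z \<in> U \<and> algebra_holomorphic_on f U \<and>
        (\<forall>\<mu>\<in>U. f \<mu> * (scaleC \<mu> 1 - x) = 0) \<longrightarrow> (\<forall>\<mu>\<in>U. f \<mu> = 0))"

text \<open>The infimum of the empty set in \<^typ>\<open>enat\<close> is \<open>\<infinity>\<close>.\<close>

definition q_l :: "'a::ring_1 \<Rightarrow> enat" where
  "q_l x = (INF n\<in>{n. range (\<lambda>a. x ^ n * a) = range (\<lambda>a. x ^ Suc n * a)}. enat n)"

definition right_topological_zero_divisor :: "'a::{real_normed_algebra, ring_1} \<Rightarrow> bool" where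
  "right_topological_zero_divisor a \<longleftrightarrow>
     (\<exists>s :: nat \<Rightarrow> 'a. (\<forall>n. norm (s n) = 1) \<and> (\<lambda>n. s n * a) \<longlonglongrightarrow> 0)"

end

(*
  Both alternatives are decided locally. Let a = x - z be B-Fredholm, b a Drazin inverse of a modulo
  the socle, and u = a^k (1 - a b), which lies in the socle. If c (a - w) = 0 with w small and
  nonzero, then c u = w^k c (1 - w b). In a semiprime algebra one may replace c by some u s c, so the
  left annihilator of a - w is nontrivial iff the map v |-> v (1 - w b)^(-1) (a - w) has a kernel on
  u A u. This space is finite dimensional (minimal idempotents e satisfy e A e = C e by
  Gelfand--Mazur), and the map is holomorphic in w, also at w = 0. By elimination over the
  meromorphic functions, either there is a holomorphic kernel function, and the right SVEP fails at
  z, or the map is bounded below by a multiple of |w|^m. The lower bound makes the left annihilators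
  of a - w trivial for small w nonzero and those of a^n stationary. Elements that are regular modulo
  the socle are regular, which turns these statements into right invertibility of a - w and
  a^n A = a^(n+1) A.
  So the set of points of Omega with right SVEP is relatively open, and so is its complement.
*)

theory Submission
  imports Defs "HOL-Complex_Analysis.Complex_Analysis"
begin

text \<open>An algebra-valued holomorphic function is reduced to scalar ones by a functional that
  does not kill a given value. The identity theorem, Liouville's theorem and the choice of a pivot
  all rest on this, hence the Hahn-Banach theorem at the start.

  The algebraic obstacle is that the left annihilator of a - w may be infinite dimensional, and so
  may A u, where c u lives. Only the two-sided sandwich u A u is finite dimensional; this is why
  semiprimeness is applied to c u. The factor (1 - w b)^(-1) undoes 1 - w b in c u = w^k c (1 - w
  b): it turns c u into a multiple of c, which a - w kills. Unlike the inverse of a - w modulo the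
  socle that is built below, it has no pole at w = 0.

  The lower bound of order m serves twice. For a fixed nonzero w only its positivity matters; as w
  tends to 0, the order m is compared with an approximate kernel function whose error has order m +
  1.\<close>

section \<open>Bounded functionals\<close>

definition sublinear :: "('a::real_vector \<Rightarrow> real) \<Rightarrow> bool" where
  "sublinear q \<longleftrightarrow> (\<forall>x y. q (x + y) \<le> q x + q y) \<and> (\<forall>t x. 0 \<le> t \<longrightarrow> q (t *\<^sub>R x) = t * q x)"

lemma sublinear_lower: "sublinear q \<Longrightarrow> - q (- x) \<le> q x"
  unfolding sublinear_def
  by (metis add.right_inverse add.commute diff_0 diff_le_eq mult_zero_left order_refl scaleR_zero_left)

text \<open>A sublinear p below \<open>q\<close> with \<open>p (- v) \<le> - q v\<close> satisfies
  \<open>p x \<le> p (x + t v) + t p (- v) \<le> q (x + t v) - t q v\<close> for t \<ge> 0, so the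
  infimum is the largest such functional. A minimal \<open>q\<close> has to coincide with it, which
  is the source of additivity.\<close>

definition lowered :: "('a::real_vector \<Rightarrow> real) \<Rightarrow> 'a \<Rightarrow> 'a \<Rightarrow> real" where
  "lowered q v x = (INF t\<in>{0..}. q (x + t *\<^sub>R v) - t * q v)"

context
  fixes q :: "'a::real_vector \<Rightarrow> real" and v :: 'a
  assumes q: "sublinear q"
begin

text \<open>Write \<open>t v = (x + t v) + (- x)\<close> and use subadditivity. The bound is free of
  t, so the infimum is finite.\<close>

lemma lowered_bound: "0 \<le> t \<Longrightarrow> - q (- x) \<le> q (x + t *\<^sub>R v) - t * q v"
  using q unfolding sublinear_def
  by (metis add.commute add_diff_cancel_right' diff_conv_add_uminus le_diff_eq minus_le_iff diff_le_eq add.assoc)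

lemma lowered_bdd: "bdd_below ((\<lambda>t. q (x + t *\<^sub>R v) - t * q v) ` {0..})"
  by (intro bdd_belowI2[where m = "- q (- x)"] lowered_bound) auto

lemma lowered_le: "0 \<le> t \<Longrightarrow> lowered q v x \<le> q (x + t *\<^sub>R v) - t * q v"
  unfolding lowered_def by (rule cINF_lower[OF lowered_bdd]) auto

lemma lowered_le_self: "lowered q v x \<le> q x"
  using lowered_le[of 0 x] by simp

lemma lowered_greatest: "(\<And>t. 0 \<le> t \<Longrightarrow> m \<le> q (x + t *\<^sub>R v) - t * q v) \<Longrightarrow> m \<le> lowered q v x"
  unfolding lowered_def by (rule cINF_greatest) auto

text \<open>Parameters s for x and t for y combine to s + t for x + y, and scaling x by r > 0 scales
  the parameter by r. The reverse inequality for r is the direct one for 1/r.\<close>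

lemma sublinear_lowered: "sublinear (lowered q v)"
proof -
  have add: "lowered q v (x + y) \<le> lowered q v x + lowered q v y" for x y
  proof -
    have "lowered q v (x + y) - (q (y + t *\<^sub>R v) - t * q v) \<le> q (x + s *\<^sub>R v) - s * q v"
      if "0 \<le> s" "0 \<le> t" for s t
    proof -
      have "lowered q v (x + y) \<le> q ((x + y) + (s + t) *\<^sub>R v) - (s + t) * q v"
        using that by (intro lowered_le) auto
      also have "(x + y) + (s + t) *\<^sub>R v = (x + s *\<^sub>R v) + (y + t *\<^sub>R v)"
        by (simp add: scaleR_add_left)
      also have "q \<dots> \<le> q (x + s *\<^sub>R v) + q (y + t *\<^sub>R v)"
        using q by (simp add: sublinear_def)
      finally show ?thesis by (simp add: algebra_simps)
    qed
    then have "lowered q v (x + y) - (q (y + t *\<^sub>R v) - t * q v) \<le> lowered q v x" if "0 \<le> t" for t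
      using that by (intro lowered_greatest) auto
    then have "lowered q v (x + y) - lowered q v x \<le> lowered q v y"
      by (intro lowered_greatest) (simp add: algebra_simps)
    then show ?thesis by simp
  qed
  have le: "lowered q v (r *\<^sub>R x) \<le> r * lowered q v x" if r: "0 < r" for r x
  proof -
    have "lowered q v (r *\<^sub>R x) / r \<le> q (x + t *\<^sub>R v) - t * q v" if "0 \<le> t" for t
    proof -
      have "lowered q v (r *\<^sub>R x) \<le> q (r *\<^sub>R x + (r * t) *\<^sub>R v) - (r * t) * q v"
        using that r by (intro lowered_le) auto
      also have "r *\<^sub>R x + (r * t) *\<^sub>R v = r *\<^sub>R (x + t *\<^sub>R v)"
        by (simp add: scaleR_add_right)
      also have "q \<dots> = r * q (x + t *\<^sub>R v)"
        using q r by (simp add: sublinear_def)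
      finally show ?thesis using r by (simp add: field_simps)
    qed
    then have "lowered q v (r *\<^sub>R x) / r \<le> lowered q v x"
      by (rule lowered_greatest)
    then show ?thesis using r by (simp add: field_simps)
  qed
  have q0: "q 0 = 0"
    using q unfolding sublinear_def by (metis mult_zero_left order_refl scaleR_zero_left)
  have "0 \<le> lowered q v 0"
    using q by (intro lowered_greatest) (auto simp: sublinear_def)
  then have zero: "lowered q v 0 = 0"
    using lowered_le_self[of 0] q0 by simp
  have "lowered q v (r *\<^sub>R x) = r * lowered q v x" if "0 \<le> r" for r x
  proof (cases "r = 0")
    case False
    then have r: "0 < r" using that by simp
    have "lowered q v (inverse r *\<^sub>R (r *\<^sub>R x)) \<le> inverse r * lowered q v (r *\<^sub>R x)"
      using r by (intro le) auto
    then have "r * lowered q v x \<le> lowered q v (r *\<^sub>R x)"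
      using r by (simp add: field_simps)
    then show ?thesis using le[OF r, of x] by simp
  qed (use zero in simp)
  then show ?thesis unfolding sublinear_def using add by blast
qed

end

text \<open>Zorn's lemma for the reversed pointwise order. A chain is bounded by its pointwise
  infimum, which \<open>- p (- x)\<close> keeps finite.\<close>

lemma minimal_sublinear_exists:
  fixes p :: "'a::real_vector \<Rightarrow> real"
  assumes p: "sublinear p"
  obtains q where "sublinear q" "\<And>x. q x \<le> p x"
    "\<And>r. sublinear r \<Longrightarrow> (\<And>x. r x \<le> q x) \<Longrightarrow> r = q"
proof -
  define A where "A = {q. sublinear q \<and> (\<forall>x. q x \<le> p x)}"
  define P where "P = (\<lambda>f g :: 'a \<Rightarrow> real. \<forall>x. g x \<le> f x)"
  have "\<exists>m\<in>A. \<forall>a\<in>A. P m a \<longrightarrow> a = m"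
  proof (rule predicate_Zorn)
    show "partial_order_on A (relation_of P A)"
      unfolding partial_order_on_def preorder_on_def refl_on_def trans_def antisym_def
        relation_of_def P_def by (auto intro!: ext intro: order_trans antisym)
  next
    fix C assume C: "C \<in> Chains (relation_of P A)"
    then have CA: "C \<subseteq> A" and ch: "\<And>f g. f \<in> C \<Longrightarrow> g \<in> C \<Longrightarrow> P f g \<or> P g f"
      by (auto simp: Chains_def relation_of_def)
    show "\<exists>u\<in>A. \<forall>a\<in>C. P a u"
    proof (cases "C = {}")
      case True
      then show ?thesis using p by (auto simp: A_def)
    next
      case False
      define u where "u x = (INF f\<in>C. f x)" for x
      have bdd: "bdd_below ((\<lambda>f. f x) ` C)" for x
      proof (rule bdd_belowI2[where m = "- p (- x)"])
        fix f assume "f \<in> C"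
        then have "sublinear f" "f (- x) \<le> p (- x)" using CA by (auto simp: A_def)
        then show "- p (- x) \<le> f x" using sublinear_lower[of f x] by simp
      qed
      have lower: "u x \<le> f x" if "f \<in> C" for f x
        unfolding u_def using bdd that by (rule cINF_lower)
      have greatest: "m \<le> u x" if "\<And>f. f \<in> C \<Longrightarrow> m \<le> f x" for m x
        unfolding u_def using False that by (rule cINF_greatest)
      have lin: "f (x + y) \<le> f x + f y" "0 \<le> t \<Longrightarrow> f (t *\<^sub>R x) = t * f x" if "f \<in> C" for f x y t
        using CA that by (auto simp: A_def sublinear_def)
      have add: "u (x + y) \<le> u x + u y" for x y
      proof -
        have "u (x + y) - g y \<le> f x" if "f \<in> C" "g \<in> C" for f g
        proof -
          \<comment> \<open>\<open>f\<close> and \<open>g\<close> are comparable; the smaller one is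
            applied to both arguments.\<close>
          have "u (x + y) \<le> f x + g y"
            using ch[OF that] lower[OF that(1), of "x + y"] lower[OF that(2), of "x + y"]
              lin(1)[OF that(1), of x y] lin(1)[OF that(2), of x y]
            unfolding P_def by (smt (verit))
          then show ?thesis by simp
        qed
        then have "u (x + y) - g y \<le> u x" if "g \<in> C" for g
          using that by (intro greatest) auto
        then have "u (x + y) - u x \<le> u y"
          by (intro greatest) (simp add: algebra_simps)
        then show ?thesis by simp
      qed
      have le: "r * u x \<le> u (r *\<^sub>R x)" if "0 \<le> r" for r x
        using that lower by (intro greatest) (auto simp: lin(2) intro: mult_left_mono)
      have "u (r *\<^sub>R x) = r * u x" if r: "0 \<le> r" for r x
      proof (cases "r = 0")
        case True
        have "f 0 = 0" if "f \<in> C" for f using lin(2)[OF that, of 0 0] by simp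
        then have "(\<lambda>f. f 0) ` C = {0}" using \<open>C \<noteq> {}\<close> by force
        then have "u 0 = 0" by (simp add: u_def)
        then show ?thesis using True by simp
      next
        case False
        then have "0 < r" using r by simp
        then show ?thesis
          using le[of "inverse r" "r *\<^sub>R x"] le[of r x] by (simp add: field_simps)
      qed
      then have "sublinear u" using add by (simp add: sublinear_def)
      moreover have "u x \<le> p x" for x
        using False lower[of _ x] CA unfolding A_def by (metis (mono_tags) CollectD ex_in_conv order_trans subsetD)
      ultimately show ?thesis using lower by (auto simp: A_def P_def)
    qed
  qed
  then obtain q where "q \<in> A" and "\<And>a. a \<in> A \<Longrightarrow> P q a \<Longrightarrow> a = q" by blast
  then show thesis
    by (intro that[of q]) (auto simp: A_def P_def intro: order_trans)
qed

text \<open>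
  Hahn--Banach: a minimal sublinear functional \<open>q\<close> is additive because \<open>lowered q y = q\<close> for
  every \<open>y\<close>; applied below the norm lowered in direction \<open>v\<close> it satisfies \<open>q (- v) \<le> - norm v\<close>.
\<close>

lemma real_functional_exists:
  fixes v :: "'a::real_normed_vector"
  obtains u :: "'a \<Rightarrow> real" where "bounded_linear u" "u v \<ge> norm v"
proof -
  have n: "sublinear (norm :: 'a \<Rightarrow> real)"
    by (simp add: sublinear_def norm_triangle_ineq)
  obtain q where q: "sublinear q" "\<And>x. q x \<le> lowered norm v x"
    and qmin: "\<And>r. sublinear r \<Longrightarrow> (\<And>x. r x \<le> q x) \<Longrightarrow> r = q"
    using minimal_sublinear_exists[OF sublinear_lowered[OF n, of v]] by metis
  have low: "lowered q y = q" for y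
    using sublinear_lowered[OF q(1)] lowered_le_self[OF q(1)] by (rule qmin)
  have add: "q (x + y) = q x + q y" for x y
  proof -
    have "q x \<le> q (x + y) - q y"
      using lowered_le[OF q(1), of 1 y x] by (simp add: low)
    moreover have "q (x + y) \<le> q x + q y" using q(1) by (simp add: sublinear_def)
    ultimately show ?thesis by simp
  qed
  have pos: "q (t *\<^sub>R x) = t * q x" if "0 \<le> t" for t x
    using q(1) that by (simp add: sublinear_def)
  have "q 0 = 0" using add[of 0 0] by simp
  then have neg: "q (- x) = - q x" for x using add[of x "- x"] by simp
  have "q (t *\<^sub>R x) = t * q x" for t x
    using pos[of t x] pos[of "- t" x] neg[of "t *\<^sub>R x"] by (cases "0 \<le> t") auto
  then have lin: "linear q" using add by (intro linearI) auto
  have qn: "q x \<le> norm x" for x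
    using q(2)[of x] lowered_le_self[OF n, of v x] by simp
  have "norm (q x) \<le> norm x * 1" for x
    using qn[of x] qn[of "- x"] neg[of x] by simp
  then have bl: "bounded_linear q"
    using lin by (intro bounded_linear.intro bounded_linear_axioms.intro exI[of _ 1]) auto
  have "q (- v) \<le> - norm v"
    using q(2)[of "- v"] lowered_le[OF n, of 1 v "- v"] by simp
  then have "q v \<ge> norm v" using neg[of v] by simp
  then show thesis using that bl by blast
qed

definition cfunctional :: "('a::complex_unital_banach_algebra \<Rightarrow> complex) \<Rightarrow> bool" where
  "cfunctional \<phi> \<longleftrightarrow> bounded_linear \<phi> \<and> (\<forall>c x. \<phi> (scaleC c x) = c * \<phi> x)"

lemma bounded_bilinear_scaleC:
  "bounded_bilinear (scaleC :: complex \<Rightarrow> 'a::complex_unital_banach_algebra \<Rightarrow> 'a)"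
  by (intro bounded_bilinear.intro exI[of _ 1])
    (auto simp: scaleC_add_left scaleC_add_right scaleR_eq_scaleC scaleC_scaleC norm_scaleC
      scaleR_conv_of_real mult.commute)

interpretation scaleC: bounded_bilinear
  "scaleC :: complex \<Rightarrow> 'a::complex_unital_banach_algebra \<Rightarrow> 'a"
  by (rule bounded_bilinear_scaleC)

lemma cfunctional_exists:
  fixes v :: "'a::complex_unital_banach_algebra"
  assumes "v \<noteq> 0"
  obtains \<phi> where "cfunctional \<phi>" "\<phi> v \<noteq> 0"
proof -
  obtain u :: "'a \<Rightarrow> real" where u: "bounded_linear u" "u v \<ge> norm v"
    using real_functional_exists by blast
  interpret u: bounded_linear u by fact
  \<comment> \<open>The complex-linear functional with real part \<open>u\<close>; complex linearity
    forces this formula.\<close>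
  define \<phi> where "\<phi> x = complex_of_real (u x) - \<i> * of_real (u (scaleC \<i> x))" for x
  have "bounded_linear \<phi>"
    unfolding \<phi>_def
    by (intro bounded_linear_sub bounded_linear_compose[OF bounded_linear_of_real]
        bounded_linear_compose[OF bounded_linear_mult_right]
        bounded_linear_compose[OF u(1)] u(1) scaleC.bounded_linear_right)
  moreover have "\<phi> (scaleC c x) = c * \<phi> x" for c x
  proof -
    have split: "scaleC d x = Re d *\<^sub>R x + Im d *\<^sub>R scaleC \<i> x" for d
      unfolding scaleR_eq_scaleC scaleC_scaleC scaleC_add_left[symmetric]
      by (metis complex_eq mult.commute)
    have "u (scaleC d x) = Re d * u x + Im d * u (scaleC \<i> x)" for d
      by (subst split) (simp add: u.add u.scaleR)
    from this[of c] this[of "\<i> * c"] show ?thesis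
      unfolding \<phi>_def scaleC_scaleC by (simp add: complex_eq_iff algebra_simps)
  qed
  moreover have "Re (\<phi> v) \<ge> norm v" using u(2) by (simp add: \<phi>_def)
  then have "\<phi> v \<noteq> 0" using assms by (metis norm_le_zero_iff zero_complex.sel(1))
  ultimately show thesis using that[of \<phi>] by (simp add: cfunctional_def)
qed

section \<open>Holomorphic functions with values in the algebra\<close>

lemma cfunctional_holomorphic:
  assumes "algebra_holomorphic_on f U" "cfunctional \<phi>"
  shows "(\<lambda>z. \<phi> (f z)) holomorphic_on U"
  unfolding holomorphic_on_def field_differentiable_def
proof
  fix z assume "z \<in> U"
  then obtain D where D: "(f has_derivative (\<lambda>h. scaleC h D)) (at z within U)"
    using assms(1) by (auto simp: algebra_holomorphic_on_def)
  have "((\<lambda>z. \<phi> (f z)) has_derivative (\<lambda>h. \<phi> (scaleC h D))) (at z within U)"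
    using assms(2) by (intro bounded_linear.has_derivative[OF _ D]) (simp add: cfunctional_def)
  moreover have "(\<lambda>h. \<phi> (scaleC h D)) = (*) (\<phi> D)"
    using assms(2) by (auto simp: cfunctional_def)
  ultimately show "\<exists>D. ((\<lambda>z. \<phi> (f z)) has_field_derivative D) (at z within U)"
    unfolding has_field_derivative_def by metis
qed

text \<open>A functional that is nonzero at a nonzero value \<open>f w\<close> would contradict the
  scalar identity theorem.\<close>

lemma algebra_analytic_continuation:
  assumes f: "algebra_holomorphic_on f U" and U: "open U" "connected U" "\<xi> \<in> U"
    and S: "S \<subseteq> U" "\<xi> islimpt S" "\<And>z. z \<in> S \<Longrightarrow> f z = 0" and "w \<in> U"
  shows "f w = 0"
proof (rule ccontr)
  assume "f w \<noteq> 0"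
  then obtain \<phi> where \<phi>: "cfunctional \<phi>" "\<phi> (f w) \<noteq> 0"
    by (rule cfunctional_exists)
  then have "\<phi> 0 = 0"
    by (simp add: cfunctional_def linear_simps(3))
  then have "\<phi> (f w) = 0"
    using S(3) by (intro analytic_continuation[OF cfunctional_holomorphic[OF f \<phi>(1)]
      U(1,2) S(1) U(3) S(2) _ \<open>w \<in> U\<close>]) auto
  with \<phi>(2) show False by simp
qed

section \<open>Minimal right ideals and the socle\<close>

lemma ring_ring_of_type: "ring (ring_of_type TYPE('a::ring_1))"
proof (rule ringI)
  show "abelian_group (ring_of_type TYPE('a))"
    by (rule abelian_groupI) (auto simp: ring_of_type_def algebra_simps intro: exI[of _ "- x" for x])
  show "Group.monoid (ring_of_type TYPE('a))"
    by unfold_locales (auto simp: ring_of_type_def algebra_simps)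
qed (auto simp: ring_of_type_def algebra_simps)

lemma ring_of_type_simps [simp]:
  "carrier (ring_of_type TYPE('a::ring_1)) = UNIV"
  "mult (ring_of_type TYPE('a)) = (*)"
  "add (ring_of_type TYPE('a)) = (+)"
  "one (ring_of_type TYPE('a)) = 1"
  "zero (ring_of_type TYPE('a)) = 0"
  by (auto simp: ring_of_type_def)

lemma a_inv_ring_of_type [simp]: "a_inv (ring_of_type TYPE('a::ring_1)) x = - x"
proof -
  interpret R: ring "ring_of_type TYPE('a)" by (rule ring_ring_of_type)
  show ?thesis by (rule R.minus_equality) auto
qed

lemma additive_subgroup_iff:
  "additive_subgroup J (ring_of_type TYPE('a::ring_1)) \<longleftrightarrow>
    0 \<in> J \<and> (\<forall>x\<in>J. \<forall>y\<in>J. x + y \<in> J) \<and> (\<forall>x\<in>J. - x \<in> J)"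
proof -
  interpret R: ring "ring_of_type TYPE('a)" by (rule ring_ring_of_type)
  have inv: "inv\<^bsub>add_monoid (ring_of_type TYPE('a))\<^esub> x = - x" for x
    using a_inv_ring_of_type[of x] unfolding a_inv_def .
  show ?thesis
  proof
    assume "additive_subgroup J (ring_of_type TYPE('a))"
    then interpret additive_subgroup J "ring_of_type TYPE('a)" .
    show "0 \<in> J \<and> (\<forall>x\<in>J. \<forall>y\<in>J. x + y \<in> J) \<and> (\<forall>x\<in>J. - x \<in> J)"
      using a_closed zero_closed a_inv_closed by auto
  next
    assume J: "0 \<in> J \<and> (\<forall>x\<in>J. \<forall>y\<in>J. x + y \<in> J) \<and> (\<forall>x\<in>J. - x \<in> J)"
    then show "additive_subgroup J (ring_of_type TYPE('a))"
      by (intro additive_subgroupI group.subgroupI[OF R.a_group]) (auto simp: inv[simplified])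
  qed
qed

lemma right_ideal_iff:
  "right_ideal J \<longleftrightarrow> 0 \<in> J \<and> (\<forall>x\<in>J. \<forall>y\<in>J. x + y \<in> J) \<and> (\<forall>x\<in>J. \<forall>a. x * a \<in> J)"
proof -
  have "- x \<in> J" if "\<forall>x\<in>J. \<forall>a. x * a \<in> J" "x \<in> J" for x
    using that by (metis mult_minus1_right)
  then show ?thesis unfolding right_ideal_def additive_subgroup_iff by blast
qed

lemma ideal_iff:
  "ideal J (ring_of_type TYPE('a::ring_1)) \<longleftrightarrow> right_ideal J \<and> (\<forall>x\<in>J. \<forall>a. a * x \<in> J)"
proof
  assume "ideal J (ring_of_type TYPE('a))"
  then interpret ideal J "ring_of_type TYPE('a)" .
  show "right_ideal J \<and> (\<forall>x\<in>J. \<forall>a. a * x \<in> J)"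
    unfolding right_ideal_def using is_additive_subgroup I_l_closed I_r_closed by auto
next
  assume "right_ideal J \<and> (\<forall>x\<in>J. \<forall>a. a * x \<in> J)"
  then show "ideal J (ring_of_type TYPE('a))"
    unfolding right_ideal_def
    by (intro idealI ring_ring_of_type additive_subgroup.a_subgroup) auto
qed

lemma right_ideal_diff: "right_ideal J \<Longrightarrow> x \<in> J \<Longrightarrow> y \<in> J \<Longrightarrow> x - y \<in> J"
  unfolding right_ideal_def additive_subgroup_iff by (metis diff_conv_add_uminus)

lemma right_ideal_zero: "right_ideal {0}"
  by (auto simp: right_ideal_iff)

lemma right_ideal_range: "right_ideal (range ((*) s))"
  unfolding right_ideal_iff
proof (intro conjI ballI allI)
  show "0 \<in> range ((*) s)" by (rule range_eqI[of _ _ 0]) simp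
  fix x y a assume "x \<in> range ((*) s)"
  then obtain b where b: "x = s * b" by blast
  show "x * a \<in> range ((*) s)" by (simp add: b mult.assoc)
  assume "y \<in> range ((*) s)"
  then obtain c where c: "y = s * c" by blast
  show "x + y \<in> range ((*) s)" by (simp add: b c flip: distrib_left)
qed

lemma minimal_right_idealD:
  assumes "minimal_right_ideal M"
  shows "right_ideal M" "M \<noteq> {0}" "\<And>K. right_ideal K \<Longrightarrow> K \<subseteq> M \<Longrightarrow> K \<noteq> {0} \<Longrightarrow> K = M"
  using assms by (auto simp: minimal_right_ideal_def)

text \<open>Left multiplication is a homomorphism of right modules. The preimage \<open>L\<close> in
  \<open>M\<close> of a right ideal below the image is \<open>{0}\<close> or \<open>M\<close>, which
  settles the two cases.\<close>

lemma minimal_right_ideal_image: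
  assumes M: "minimal_right_ideal M" and nz: "(*) a ` M \<noteq> {0}"
  shows "minimal_right_ideal ((*) a ` M)"
proof -
  have rM: "right_ideal M" using M by (rule minimal_right_idealD)
  have im: "right_ideal ((*) a ` M)"
    unfolding right_ideal_iff
  proof (intro conjI ballI allI)
    show "0 \<in> (*) a ` M" using rM by (intro image_eqI[of _ _ 0]) (auto simp: right_ideal_iff)
    fix x y b assume "x \<in> (*) a ` M"
    then obtain m where m: "m \<in> M" "x = a * m" by blast
    show "x * b \<in> (*) a ` M"
      using m rM by (auto simp: mult.assoc right_ideal_iff)
    assume "y \<in> (*) a ` M"
    then obtain n where n: "n \<in> M" "y = a * n" by blast
    have "m + n \<in> M" using m n rM by (auto simp: right_ideal_iff)
    then show "x + y \<in> (*) a ` M" unfolding m n by (simp flip: distrib_left)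
  qed
  moreover have "K = {0} \<or> K = (*) a ` M" if K: "right_ideal K" "K \<subseteq> (*) a ` M" for K
  proof -
    define L where "L = {m \<in> M. a * m \<in> K}"
    have "right_ideal L" "L \<subseteq> M"
      using rM K(1) unfolding right_ideal_iff L_def
      by (auto simp: distrib_left mult.assoc[symmetric])
    then consider "L = {0}" | "L = M"
      using M unfolding minimal_right_ideal_def by blast
    then show ?thesis
    proof cases
      case 1
      have "k = 0" if k: "k \<in> K" for k
      proof -
        obtain m where m: "m \<in> M" "k = a * m" using k K(2) by blast
        then have "m \<in> L" using k by (simp add: L_def)
        then show ?thesis using 1 m by simp
      qed
      then show ?thesis using K(1) by (auto simp: right_ideal_iff)
    next
      case 2
      then show ?thesis using K(2) by (auto simp: L_def)
    qed
  qed
  ultimately show ?thesis using nz by (auto simp: minimal_right_ideal_def)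
qed

text \<open>Semiprimeness speaks of two-sided ideals, so \<open>a\<close> must be placed in one with
  square zero. \<open>I\<close> is the right annihilator of a A, a two-sided ideal, and
  \<open>J\<close> is the part of \<open>I\<close> that kills \<open>I\<close> from the left. Then J
  J = 0, and \<open>a\<close> lies in \<open>J\<close>.\<close>

lemma semiprime_elementwise:
  fixes a :: "'a::ring_1"
  assumes sp: "semiprime TYPE('a)" and a: "\<And>r. a * r * a = 0"
  shows "a = 0"
proof -
  define I where "I = {z. \<forall>r. a * r * z = 0}"
  define J where "J = {z. z \<in> I \<and> (\<forall>j\<in>I. z * j = 0)}"
  have "ideal J (ring_of_type TYPE('a))"
    unfolding ideal_iff right_ideal_iff
  proof (intro conjI ballI allI)
    have mul: "b * z \<in> I \<and> z * b \<in> I" if "z \<in> I" for z b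
    proof -
      have z: "a * r * z = 0" for r using that by (simp add: I_def)
      have "a * r * (b * z) = a * (r * b) * z" "a * r * (z * b) = a * r * z * b" for r
        by (simp_all only: mult.assoc)
      then show ?thesis using z by (simp add: I_def)
    qed
    have add: "y + z \<in> I" if "y \<in> I" "z \<in> I" for y z
      using that by (auto simp: I_def distrib_left)
    show "0 \<in> J" by (simp add: J_def I_def)
    fix y z b assume "y \<in> J"
    then show "y * b \<in> J" "b * y \<in> J" using mul by (auto simp: J_def mult.assoc)
    assume "z \<in> J" then show "y + z \<in> J"
      using \<open>y \<in> J\<close> add by (auto simp: J_def distrib_right)
  qed
  moreover have "J \<cdot>\<^bsub>ring_of_type TYPE('a)\<^esub> J = {0}"
  proof
    show "J \<cdot>\<^bsub>ring_of_type TYPE('a)\<^esub> J \<subseteq> {0}"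
    proof
      fix z assume "z \<in> J \<cdot>\<^bsub>ring_of_type TYPE('a)\<^esub> J"
      then show "z \<in> {0}"
        by (induction rule: ideal_prod.induct) (auto simp: J_def)
    qed
    have "0 \<otimes>\<^bsub>ring_of_type TYPE('a)\<^esub> 0 \<in> J \<cdot>\<^bsub>ring_of_type TYPE('a)\<^esub> J"
      by (rule ideal_prod.prod) (auto simp: J_def I_def)
    then show "{0} \<subseteq> J \<cdot>\<^bsub>ring_of_type TYPE('a)\<^esub> J" by simp
  qed
  ultimately have "J = {0}" using sp by (simp add: semiprime_def)
  moreover have "a * z = 0" if "z \<in> I" for z
  proof -
    have "a * 1 * z = 0" using that unfolding I_def by blast
    then show ?thesis by simp
  qed
  then have "a \<in> J" using a by (auto simp: J_def I_def)
  ultimately show ?thesis by simp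
qed

text \<open>Brauer's lemma. Some \<open>n\<close> in \<open>M\<close> has n M \<noteq> 0, so n M = M
  and \<open>n = n * e\<close> for some \<open>e\<close> in \<open>M\<close>. Left multiplication by
  \<open>n\<close> is injective on \<open>M\<close>, and it kills \<open>e * k - k\<close>.\<close>

lemma minimal_right_ideal_idempotent:
  fixes M :: "'a::ring_1 set"
  assumes sp: "semiprime TYPE('a)" and M: "minimal_right_ideal M"
  obtains e where "e \<in> M" "e \<noteq> 0" "\<And>m. m \<in> M \<Longrightarrow> e * m = m"
proof -
  have rM: "right_ideal M" using M by (rule minimal_right_idealD)
  then obtain m where m: "m \<in> M" "m \<noteq> 0"
    using minimal_right_idealD(2)[OF M] by (auto simp: right_ideal_iff)
  then obtain c where "m * c * m \<noteq> 0" using semiprime_elementwise[OF sp] by blast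
  define n where "n = m * c"
  have n: "n \<in> M" "n * m \<noteq> 0"
    using \<open>m * c * m \<noteq> 0\<close> rM m by (auto simp: n_def right_ideal_iff)
  have im: "(*) n ` M \<noteq> {0}" using n m by blast
  have "(*) n ` M \<subseteq> M" using n rM by (auto simp: right_ideal_iff)
  then have "(*) n ` M = M"
    using minimal_right_ideal_image[OF M im] minimal_right_idealD[OF M]
    by (simp add: minimal_right_ideal_def)
  then obtain e where e: "e \<in> M" "n * e = n" using n(1) by (metis imageE)
  define L where "L = {y \<in> M. n * y = 0}"
  have "right_ideal L" "L \<subseteq> M" "L \<noteq> M"
    using rM n m unfolding right_ideal_iff L_def by (auto simp: distrib_left simp flip: mult.assoc)
  then have "L = {0}" using M unfolding minimal_right_ideal_def by blast
  have "e * k = k" if "k \<in> M" for k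
  proof -
    have "e * k - k \<in> L"
      using e that rM right_ideal_diff[OF rM, of "e * k" k]
      by (auto simp: L_def right_ideal_iff right_diff_distrib simp flip: mult.assoc)
    then show ?thesis using \<open>L = {0}\<close> by simp
  qed
  moreover have "e \<noteq> 0" using e n by auto
  ultimately show thesis using that e by blast
qed

section \<open>Sums of right ideals, left units and regularity of the socle\<close>

definition ideal_sum :: "'a::plus set \<Rightarrow> 'a set \<Rightarrow> 'a set" where
  "ideal_sum J K = {j + k | j k. j \<in> J \<and> k \<in> K}"

lemma subset_ideal_sum:
  assumes "right_ideal K"
  shows "J \<subseteq> ideal_sum J K"
proof
  fix j assume "j \<in> J"
  then have "j + 0 \<in> ideal_sum J K"
    using assms unfolding ideal_sum_def right_ideal_iff by blast
  then show "j \<in> ideal_sum J K" by simp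
qed

lemma subset_ideal_sum_right:
  assumes "right_ideal J"
  shows "K \<subseteq> ideal_sum J K"
proof
  fix k assume "k \<in> K"
  then have "0 + k \<in> ideal_sum J K"
    using assms unfolding ideal_sum_def right_ideal_iff by blast
  then show "k \<in> ideal_sum J K" by simp
qed

lemma right_ideal_ideal_sum:
  assumes "right_ideal J" "right_ideal K"
  shows "right_ideal (ideal_sum J K)"
  unfolding right_ideal_iff ideal_sum_def
proof (intro conjI ballI allI)
  show "0 \<in> {j + k |j k. j \<in> J \<and> k \<in> K}"
    using assms by (force simp: right_ideal_iff)
  fix x y a assume x: "x \<in> {j + k |j k. j \<in> J \<and> k \<in> K}"
  then obtain j k where jk: "x = j + k" "j \<in> J" "k \<in> K" by blast
  then have "x * a = j * a + k * a" by (simp add: distrib_right)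
  then show "x * a \<in> {j + k |j k. j \<in> J \<and> k \<in> K}"
    using assms jk unfolding right_ideal_iff by blast
  assume "y \<in> {j + k |j k. j \<in> J \<and> k \<in> K}"
  then obtain j' k' where jk': "y = j' + k'" "j' \<in> J" "k' \<in> K" by blast
  then have "x + y = (j + j') + (k + k')" using jk by (simp add: algebra_simps)
  then show "x + y \<in> {j + k |j k. j \<in> J \<and> k \<in> K}"
    using assms jk jk' unfolding right_ideal_iff by blast
qed

text \<open>Finitely many minimal right ideals are added one at a time. The base \<open>J\<close> is
  arbitrary so that the same chain can be started from \<open>{0}\<close> and from a principal right
  ideal.\<close>

inductive minimal_ext :: "'a::ring_1 set \<Rightarrow> 'a set \<Rightarrow> bool" for J where
  refl: "minimal_ext J J"
| step: "minimal_ext J K \<Longrightarrow> minimal_right_ideal M \<Longrightarrow> minimal_ext J (ideal_sum K M)"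

text \<open>For a right ideal this means \<open>J = p A\<close> with p idempotent, that is,
  \<open>J\<close> is a direct summand of the algebra.\<close>

definition left_unital :: "'a::times set \<Rightarrow> bool" where
  "left_unital J \<longleftrightarrow> (\<exists>p\<in>J. \<forall>j\<in>J. p * j = j)"

lemma minimal_ext_right_ideal: "minimal_ext J K \<Longrightarrow> right_ideal J \<Longrightarrow> right_ideal K"
  by (induction rule: minimal_ext.induct) (auto intro: right_ideal_ideal_sum minimal_right_idealD)

text \<open>With \<open>p\<close> a left unit of \<open>K\<close>, the sum K + M equals K + (1 - p)
  M, and (1 - p) M is zero or again minimal, hence has a left unit \<open>f\<close> by Brauer's
  lemma.\<close>

lemma left_unital_ideal_sum:
  fixes K :: "'a::ring_1 set"
  assumes sp: "semiprime TYPE('a)" and K: "right_ideal K" "left_unital K"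
    and M: "minimal_right_ideal M"
  shows "left_unital (ideal_sum K M)"
proof -
  obtain p where p: "p \<in> K" "\<And>k. k \<in> K \<Longrightarrow> p * k = k"
    using K(2) by (auto simp: left_unital_def)
  have rM: "right_ideal M" using M by (rule minimal_right_idealD)
  have pp: "p * p = p" using p by blast
  have memK: "k \<in> ideal_sum K M" if "k \<in> K" for k
    using that subset_ideal_sum[OF rM] by blast
  show ?thesis
  proof (cases "(*) (1 - p) ` M = {0}")
    case True
    have "p * m = m" if "m \<in> M" for m
    proof -
      have "(1 - p) * m \<in> {0}" using True that by blast
      then show ?thesis by (simp add: left_diff_distrib)
    qed
    then have "p * (k + m) = k + m" if "k \<in> K" "m \<in> M" for k m
      using that p by (simp add: distrib_left)
    then show ?thesis
      using memK[OF p(1)] unfolding left_unital_def ideal_sum_def by blast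
  next
    case False
    then have "minimal_right_ideal ((*) (1 - p) ` M)"
      by (rule minimal_right_ideal_image[OF M])
    then obtain f where f: "f \<in> (*) (1 - p) ` M" "\<And>m. m \<in> (*) (1 - p) ` M \<Longrightarrow> f * m = m"
      using minimal_right_ideal_idempotent[OF sp] by metis
    obtain m0 where m0: "m0 \<in> M" "f = m0 - p * m0"
      using f(1) by (auto simp: left_diff_distrib)
    have pf: "p * f = 0"
      using pp by (simp add: m0 right_diff_distrib flip: mult.assoc)
    \<comment> \<open>Here \<open>p * f = 0\<close>, but \<open>f * p\<close> need not vanish.
      Subtracting it makes \<open>g\<close> the identity both on \<open>K\<close>, where p k = k,
      and on (1 - p) M, which \<open>p\<close> kills.\<close>
    define g where "g = p + f - f * p"
    have rs: "right_ideal (ideal_sum K M)"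
      using K(1) rM by (rule right_ideal_ideal_sum)
    have memM: "m \<in> ideal_sum K M" if "m \<in> M" for m
      using that subset_ideal_sum_right[OF K(1)] by blast
    have "f \<in> ideal_sum K M"
      unfolding m0 using p m0 K(1) by (intro right_ideal_diff[OF rs] memK memM) (auto simp: right_ideal_iff)
    then have "g \<in> ideal_sum K M"
      unfolding g_def using rs memK[OF p(1)] by (intro right_ideal_diff[OF rs]) (auto simp: right_ideal_iff)
    moreover have gk: "g * k = k" if "k \<in> K" for k
      using p(2)[OF that] by (simp add: g_def algebra_simps)
    have "g * m = m" if "m \<in> M" for m
    proof -
      have "g * (p * m) = p * m" using p(1) K(1) by (intro gk) (auto simp: right_ideal_iff)
      moreover have "g * (m - p * m) = m - p * m"
      proof -
        have "f * (m - p * m) = m - p * m" using that by (intro f(2)) (auto simp: left_diff_distrib)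
        moreover have "p * (m - p * m) = 0"
          using pp by (simp add: right_diff_distrib flip: mult.assoc)
        ultimately show ?thesis
          by (simp add: g_def left_diff_distrib distrib_right mult.assoc)
      qed
      ultimately show ?thesis by (simp add: right_diff_distrib)
    qed
    then have "g * (k + m) = k + m" if "k \<in> K" "m \<in> M" for k m
      using that gk by (simp add: distrib_left)
    ultimately show ?thesis unfolding left_unital_def ideal_sum_def by blast
  qed
qed

text \<open>If the sum is direct, the component \<open>j\<close> in \<open>J\<close> of a left unit
  of the sum is a left unit of \<open>J\<close>: the defect \<open>k - j * k = m * k\<close> lies in
  both summands. Otherwise \<open>M\<close> is already contained in \<open>J\<close>.\<close>

lemma left_unital_summand:
  assumes J: "right_ideal J" and M: "minimal_right_ideal M"
    and u: "left_unital (ideal_sum J M)"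
  shows "left_unital J"
proof -
  have rM: "right_ideal M" using M by (rule minimal_right_idealD)
  have "right_ideal (J \<inter> M)" using J rM by (auto simp: right_ideal_iff)
  then consider "J \<inter> M = M" | "J \<inter> M = {0}"
    using M unfolding minimal_right_ideal_def by blast
  then show ?thesis
  proof cases
    case 1
    then have "M \<subseteq> J" by blast
    then have "ideal_sum J M \<subseteq> J"
      using J unfolding ideal_sum_def right_ideal_iff by blast
    moreover have "J \<subseteq> ideal_sum J M" using rM by (rule subset_ideal_sum)
    ultimately have "ideal_sum J M = J" by blast
    then show ?thesis using u by simp
  next
    case 2
    obtain p where p: "p \<in> ideal_sum J M" "\<And>k. k \<in> ideal_sum J M \<Longrightarrow> p * k = k"
      using u by (auto simp: left_unital_def)
    then obtain j m where jm: "j \<in> J" "m \<in> M" "p = j + m" by (auto simp: ideal_sum_def)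
    have "j * k = k" if "k \<in> J" for k
    proof -
      have "k \<in> ideal_sum J M"
        using that subset_ideal_sum[OF rM] by blast
      then have "m * k = k - j * k" using p(2) jm by (simp add: algebra_simps)
      moreover have "m * k \<in> M" "k - j * k \<in> J"
        using rM J jm that by (auto simp: right_ideal_iff intro!: right_ideal_diff[OF J])
      ultimately have "k - j * k \<in> J \<inter> M" by simp
      then show ?thesis using 2 by simp
    qed
    then show ?thesis using jm by (auto simp: left_unital_def)
  qed
qed

lemma left_unital_minimal_ext:
  fixes J :: "'a::ring_1 set"
  assumes "semiprime TYPE('a)" "minimal_ext J K" "right_ideal J" "left_unital J"
  shows "left_unital K"
  using assms(2)
proof (induction rule: minimal_ext.induct)
  case (step K M)
  show ?case
    using assms(1) minimal_ext_right_ideal[OF step.hyps(1) assms(3)] step.IH step.hyps(2)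
    by (rule left_unital_ideal_sum)
qed (fact assms(4))

lemma left_unital_minimal_ext_rev:
  assumes "minimal_ext J K" "right_ideal J" "left_unital K"
  shows "left_unital J"
  using assms(1,3)
proof (induction rule: minimal_ext.induct)
  case (step K M)
  have "left_unital K"
    using minimal_ext_right_ideal[OF step.hyps(1) assms(2)] step.hyps(2) step.prems
    by (rule left_unital_summand)
  then show ?case by (rule step.IH)
qed

lemma ideal_sum_right_commute:
  "ideal_sum (ideal_sum J K) M = ideal_sum (ideal_sum J M) (K :: 'a::ab_semigroup_add set)"
proof -
  have "ideal_sum (ideal_sum J K) M \<subseteq> ideal_sum (ideal_sum J M) K" for K M :: "'a set"
  proof
    fix x assume "x \<in> ideal_sum (ideal_sum J K) M"
    then obtain j k m where "x = j + k + m" "j \<in> J" "k \<in> K" "m \<in> M"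
      by (auto simp: ideal_sum_def)
    then have "x = (j + m) + k" "j + m \<in> ideal_sum J M"
      by (auto simp: ideal_sum_def ac_simps)
    then show "x \<in> ideal_sum (ideal_sum J M) K"
      using \<open>k \<in> K\<close> unfolding ideal_sum_def[of "ideal_sum J M"] by blast
  qed
  then show ?thesis by blast
qed

lemma minimal_ext_ideal_sum: "minimal_ext J K \<Longrightarrow> minimal_ext (ideal_sum J L) (ideal_sum K L)"
  by (induction rule: minimal_ext.induct)
    (auto simp: ideal_sum_right_commute[of _ _ L] intro: minimal_ext.intros)

lemma socle_minimal_ext:
  assumes "s \<in> socle"
  obtains K where "minimal_ext {0} K" "s \<in> K"
proof -
  obtain \<F> t where F: "finite \<F>" "\<forall>J\<in>\<F>. minimal_right_ideal J \<and> t J \<in> J" and s: "s = sum t \<F>"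
    using assms by (auto simp: socle_def)
  have "\<exists>K. minimal_ext {0} K \<and> sum t \<F> \<in> K"
    using F
  proof (induction \<F>)
    case empty
    then show ?case by (auto intro: minimal_ext.refl)
  next
    case (insert J \<F>)
    then obtain K where K: "minimal_ext {0} K" "sum t \<F> \<in> K" by auto
    have "sum t (insert J \<F>) = sum t \<F> + t J"
      using insert by (simp add: add.commute)
    then have "sum t (insert J \<F>) \<in> ideal_sum K J"
      using K(2) insert.prems unfolding ideal_sum_def by blast
    moreover have "minimal_ext {0} (ideal_sum K J)"
      using K(1) insert.prems by (blast intro: minimal_ext.step)
    ultimately show ?case by blast
  qed
  then show thesis using s that by blast
qed

text \<open>A finite sum \<open>K\<close> of minimal right ideals containing \<open>s\<close> has a
  left unit by going up from \<open>{0}\<close>. Since s A lies in \<open>K\<close>, the same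
  \<open>K\<close> is also reached from s A, and going down gives s A a left unit
  \<open>s * d\<close>, so \<open>s * d * s = s\<close>.\<close>

lemma socle_regular:
  fixes s :: "'a::ring_1"
  assumes sp: "semiprime TYPE('a)" and s: "s \<in> socle"
  obtains d where "s * d * s = s"
proof -
  obtain K where K: "minimal_ext {0} K" "s \<in> K" using socle_minimal_ext[OF s] .
  have rK: "right_ideal K" using K(1) right_ideal_zero by (rule minimal_ext_right_ideal)
  have "left_unital K"
    using sp K(1) right_ideal_zero by (rule left_unital_minimal_ext) (simp add: left_unital_def)
  moreover have "ideal_sum K (range ((*) s)) \<subseteq> K"
    using K(2) rK unfolding ideal_sum_def right_ideal_iff by blast
  then have "ideal_sum K (range ((*) s)) = K"
    using subset_ideal_sum[OF right_ideal_range] by blast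
  moreover have "ideal_sum {0} (range ((*) s)) = range ((*) s)"
    by (auto simp: ideal_sum_def)
  ultimately have "left_unital (range ((*) s))"
    using minimal_ext_ideal_sum[OF K(1), of "range ((*) s)"]
    by (auto intro: left_unital_minimal_ext_rev right_ideal_range)
  then obtain d where "s * d * (s * 1) = s * 1"
    unfolding left_unital_def by blast
  then show thesis using that by simp
qed

section \<open>The socle as a two-sided ideal, and regularity modulo it\<close>

lemma minimal_subset_socle: "minimal_right_ideal M \<Longrightarrow> M \<subseteq> socle"
  unfolding socle_def by (auto intro!: exI[of _ "{M}"] exI[of _ "\<lambda>_. m" for m])

lemma socle_0: "0 \<in> socle"
  unfolding socle_def by (auto intro!: exI[of _ "{}"])

lemma socle_add:
  assumes "s \<in> socle" "t \<in> socle"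
  shows "s + t \<in> socle"
proof -
  obtain F f where F: "finite F" "\<forall>J\<in>F. minimal_right_ideal J \<and> f J \<in> J" "s = sum f F"
    using assms(1) by (auto simp: socle_def)
  obtain G g where G: "finite G" "\<forall>J\<in>G. minimal_right_ideal J \<and> g J \<in> J" "t = sum g G"
    using assms(2) by (auto simp: socle_def)
  \<comment> \<open>\<open>socle\<close> allows one summand per minimal right ideal. Both families
    are padded with 0 over the union, and summands in the same ideal are merged.\<close>
  define f' where "f' J = (if J \<in> F then f J else 0)" for J
  define g' where "g' J = (if J \<in> G then g J else 0)" for J
  have "s = sum f' (F \<union> G)" "t = sum g' (F \<union> G)"
    unfolding F(3) G(3) f'_def g'_def using F(1) G(1)
    by (auto simp: sum.If_cases Int_absorb1 Int_absorb2 intro!: sum.mono_neutral_cong_left)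
  then have "s + t = (\<Sum>J\<in>F \<union> G. f' J + g' J)"
    by (simp add: sum.distrib)
  moreover have "minimal_right_ideal J \<and> f' J + g' J \<in> J" if "J \<in> F \<union> G" for J
  proof -
    have M: "minimal_right_ideal J" using that F(2) G(2) by blast
    then have "right_ideal J" by (rule minimal_right_idealD)
    then show ?thesis using M F(2) G(2) by (auto simp: f'_def g'_def right_ideal_iff)
  qed
  ultimately show ?thesis
    unfolding socle_def using F(1) G(1) by (auto intro!: exI[of _ "F \<union> G"])
qed

text \<open>Closure on the left holds because a left multiple of a minimal right ideal is zero or
  minimal.\<close>

lemma ideal_socle: "ideal (socle :: 'a set) (ring_of_type TYPE('a::ring_1))"
proof -
  have sums: "sum f F \<in> (socle :: 'a set)" if "\<And>i. i \<in> F \<Longrightarrow> f i \<in> socle" for f and F :: "'a set set"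
    using that by (induction F rule: infinite_finite_induct) (auto intro: socle_0 socle_add)
  have "s * a \<in> socle \<and> a * s \<in> socle" if s: "s \<in> socle" for s a :: 'a
  proof -
    obtain F f where F: "finite F" "\<forall>J\<in>F. minimal_right_ideal J \<and> f J \<in> J" "s = sum f F"
      using s by (auto simp: socle_def)
    have "f J * a \<in> socle" "a * f J \<in> socle" if "J \<in> F" for J
    proof -
      have J: "minimal_right_ideal J" "f J \<in> J" using F(2) that by auto
      then have "f J * a \<in> J" using minimal_right_idealD(1)[OF J(1)] by (simp add: right_ideal_iff)
      then show "f J * a \<in> socle" using minimal_subset_socle[OF J(1)] by blast
      have "a * f J \<in> (*) a ` J" using J(2) by blast
      then show "a * f J \<in> socle"
        using minimal_subset_socle[OF minimal_right_ideal_image[OF J(1), of a]] socle_0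
        by (cases "(*) a ` J = {0}") auto
    qed
    then show ?thesis
      unfolding F(3) sum_distrib_left sum_distrib_right by (auto intro: sums)
  qed
  then show ?thesis
    unfolding ideal_iff right_ideal_iff using socle_0 socle_add by blast
qed

lemma socle_mult_left: "s \<in> socle \<Longrightarrow> a * s \<in> socle"
  and socle_mult_right: "s \<in> socle \<Longrightarrow> s * a \<in> socle"
  using ideal_socle by (auto simp: ideal_iff right_ideal_iff)

lemma socle_diff: "s \<in> socle \<Longrightarrow> t \<in> socle \<Longrightarrow> s - t \<in> socle"
  using ideal_socle by (auto simp: ideal_iff intro: right_ideal_diff)

text \<open>The defect \<open>w = y - y * c * y\<close> has an inner inverse \<open>d\<close> and
  factors both as y (1 - c y) and as (1 - y c) y. The correction added to \<open>c\<close>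
  contributes \<open>w * d * w = w\<close>, exactly what is missing.\<close>

lemma regular_mod_socle:
  fixes y :: "'a::ring_1"
  assumes sp: "semiprime TYPE('a)" and y: "y - y * c * y \<in> socle"
  obtains g where "y * g * y = y"
proof -
  define w where "w = y - y * c * y"
  obtain d where d: "w * d * w = w" using socle_regular[OF sp] y unfolding w_def by blast
  define g where "g = c + (1 - c * y) * d * (1 - y * c)"
  have "w = y * (1 - c * y)" "w = (1 - y * c) * y"
    by (simp_all add: w_def algebra_simps)
  then have "y * g * y = y * c * y + w * d * w"
    by (simp only: g_def distrib_left distrib_right mult.assoc)
  then have "y * g * y = y" using d by (simp add: w_def)
  then show thesis using that by blast
qed

section \<open>Drazin invertibility modulo the socle\<close>

lemma B_Fredholm_lift:
  fixes a :: "'a::ring_1"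
  assumes "B_Fredholm a"
  obtains b k where "b * a * b - b \<in> socle" "a * b - b * a \<in> socle"
    "a ^ k * b * a - a ^ k \<in> socle"
proof -
  interpret ideal "socle :: 'a set" "ring_of_type TYPE('a)" by (rule ideal_socle)
  let ?Q = "ring_of_type TYPE('a) Quot socle"
  let ?c = "\<lambda>x :: 'a. socle +>\<^bsub>ring_of_type TYPE('a)\<^esub> x"
  interpret Q: ring ?Q by (rule quotient_is_ring)
  have mult: "?c x \<otimes>\<^bsub>?Q\<^esub> ?c y = ?c (x * y)" for x y
    using rcoset_mult_add[of x y] by (simp add: FactRing_def)
  have one: "\<one>\<^bsub>?Q\<^esub> = ?c 1" by (simp add: FactRing_def)
  have pow: "?c x [^]\<^bsub>?Q\<^esub> n = ?c (x ^ n)" for x and n :: nat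
    by (induction n) (simp_all add: one mult power_Suc2 del: power_Suc)
  have eq: "?c x = ?c y \<longleftrightarrow> x - y \<in> socle" for x y
    using quotient_eq_iff_same_a_r_cos[OF ideal_socle, of x y] by (simp add: a_minus_def)
  obtain B k where B: "B \<in> carrier ?Q" "B \<otimes>\<^bsub>?Q\<^esub> ?c a \<otimes>\<^bsub>?Q\<^esub> B = B"
    "?c a \<otimes>\<^bsub>?Q\<^esub> B = B \<otimes>\<^bsub>?Q\<^esub> ?c a"
    "?c a [^]\<^bsub>?Q\<^esub> (k::nat) \<otimes>\<^bsub>?Q\<^esub> B \<otimes>\<^bsub>?Q\<^esub> ?c a = ?c a [^]\<^bsub>?Q\<^esub> k"
    using assms unfolding B_Fredholm_def drazin_invertible_def by blast
  obtain b where b: "B = ?c b"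
    using B(1) by (auto simp: FactRing_def A_RCOSETS_def')
  show thesis
    using B(2-) that[of b k] unfolding b pow mult eq by blast
qed

lemma socle_cong_trans: "x - y \<in> socle \<Longrightarrow> y - z \<in> socle \<Longrightarrow> x - z \<in> socle"
  using socle_add[of "x - y" "y - z"] by simp

lemma socle_cong_mult_left: "x - y \<in> socle \<Longrightarrow> a * x - a * y \<in> socle"
  using socle_mult_left[of "x - y" a] by (simp add: right_diff_distrib)

lemma socle_cong_mult_right: "x - y \<in> socle \<Longrightarrow> x * a - y * a \<in> socle"
  using socle_mult_right[of "x - y" a] by (simp add: left_diff_distrib)

lemma socle_cong_sym: "x - y \<in> socle \<Longrightarrow> y - x \<in> socle"
  using socle_diff[OF socle_0, of "x - y"] by simp

text \<open>Modulo the socle, a b is an idempotent that commutes with \<open>a\<close>, equals a^m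
  b^m for m \<ge> 1 and fixes a^k. The first two conclusions serve to invert a - z modulo the socle,
  the third to make high powers of \<open>a\<close> regular.\<close>

lemma B_Fredholm_drazin_data:
  fixes a :: "'a::ring_1"
  assumes "B_Fredholm a"
  obtains b k where "a ^ k * (1 - a * b) \<in> socle" "b - a * b * b \<in> socle"
    "\<And>m. k < m \<Longrightarrow> a ^ m - a ^ m * b ^ m * a ^ m \<in> socle"
proof -
  obtain b k where b: "b * a * b - b \<in> socle" "a * b - b * a \<in> socle"
    "a ^ k * b * a - a ^ k \<in> socle"
    using B_Fredholm_lift[OF assms] .
  have u: "a ^ k * (a * b) - a ^ k \<in> socle"
    using socle_cong_trans[OF socle_cong_mult_left[OF b(2), of "a ^ k"]] b(3)
    by (simp add: mult.assoc)
  have v: "a * b * b - b \<in> socle"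
    using socle_cong_trans[OF socle_cong_mult_right[OF b(2), of b] b(1)] .
  have pq: "a ^ Suc m * b ^ Suc m - a * b \<in> socle" for m
  proof (induction m)
    case (Suc m)
    have "a ^ Suc (Suc m) * b ^ Suc (Suc m) = a * (a ^ Suc m * b ^ Suc m) * b"
      by (simp add: mult.assoc power_commutes)
    moreover have "a * (a ^ Suc m * b ^ Suc m) * b - a * (a * b) * b \<in> socle"
      by (intro socle_cong_mult_right socle_cong_mult_left Suc.IH)
    moreover have "a * (a * b) * b - a * b \<in> socle"
      using socle_cong_mult_left[OF v, of a] by (simp add: mult.assoc)
    ultimately show ?case using socle_cong_trans by metis
  qed (simp add: socle_0)
  have comm1: "a * b * a - a * (a * b) \<in> socle"
    using socle_cong_mult_left[OF socle_cong_sym[OF b(2)], of a] by (simp add: mult.assoc)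
  have comm: "a * b * a ^ m - a ^ m * (a * b) \<in> socle" for m
  proof (induction m)
    case (Suc m)
    have "a * b * a ^ Suc m - a * (a * b) * a ^ m \<in> socle"
      using socle_cong_mult_right[OF comm1, of "a ^ m"] by (simp add: mult.assoc)
    moreover have "a * (a * b) * a ^ m - a ^ Suc m * (a * b) \<in> socle"
      using socle_cong_mult_left[OF Suc.IH, of a] by (simp add: mult.assoc)
    ultimately show ?case by (rule socle_cong_trans)
  qed (simp add: socle_0)
  \<comment> \<open>The strict inequality makes the exponent positive, as \<open>pq\<close>
    requires; with m = 0 the product of the powers would be 1 instead of a b.\<close>
  have "a ^ m - a ^ m * b ^ m * a ^ m \<in> socle" if km: "k < m" for m
  proof -
    obtain n where n: "m = Suc n" using km by (cases m) auto
    have "a ^ m * b ^ m * a ^ m - a * b * a ^ m \<in> socle"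
      unfolding n by (rule socle_cong_mult_right[OF pq])
    moreover note comm[of m]
    moreover have "a ^ (m - k) * a ^ k = a ^ m"
      using km by (simp flip: power_add)
    then have "a ^ m * (a * b) - a ^ m \<in> socle"
      using socle_cong_mult_left[OF u, of "a ^ (m - k)"] by (simp flip: mult.assoc)
    ultimately show ?thesis
      using socle_cong_trans socle_cong_sym by metis
  qed
  moreover have "a ^ k * (1 - a * b) \<in> socle"
    using socle_cong_sym[OF u] by (simp add: right_diff_distrib)
  ultimately show thesis using that socle_cong_sym[OF v] by blast
qed

section \<open>Resolvents\<close>

lemma algebra_holomorphic_on_const: "algebra_holomorphic_on (\<lambda>_. c) U"
proof -
  have "((\<lambda>_. c) has_derivative (\<lambda>h. scaleC h 0)) (at z within U)" for z
    unfolding scaleC.zero_right by (rule has_derivative_const)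
  then show ?thesis unfolding algebra_holomorphic_on_def by blast
qed

lemma algebra_holomorphic_on_sum:
  assumes "\<And>i. i \<in> I \<Longrightarrow> algebra_holomorphic_on (f i) U"
  shows "algebra_holomorphic_on (\<lambda>z. \<Sum>i\<in>I. f i z) U"
  unfolding algebra_holomorphic_on_def
proof
  fix z assume "z \<in> U"
  then have "\<forall>i\<in>I. \<exists>D. (f i has_derivative (\<lambda>h. scaleC h D)) (at z within U)"
    using assms unfolding algebra_holomorphic_on_def by blast
  from bchoice[OF this] obtain D
    where "\<And>i. i \<in> I \<Longrightarrow> (f i has_derivative (\<lambda>h. scaleC h (D i))) (at z within U)"
    by blast
  then have "((\<lambda>z. \<Sum>i\<in>I. f i z) has_derivative (\<lambda>h. \<Sum>i\<in>I. scaleC h (D i))) (at z within U)"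
    by (rule has_derivative_sum)
  then show "\<exists>D. ((\<lambda>z. \<Sum>i\<in>I. f i z) has_derivative (\<lambda>h. scaleC h D)) (at z within U)"
    unfolding scaleC.sum_right[symmetric] by blast
qed

lemma algebra_holomorphic_on_mult:
  assumes "algebra_holomorphic_on f U" "algebra_holomorphic_on g U"
  shows "algebra_holomorphic_on (\<lambda>z. f z * g z) U"
  unfolding algebra_holomorphic_on_def
proof
  fix z assume "z \<in> U"
  then obtain D E where "(f has_derivative (\<lambda>h. scaleC h D)) (at z within U)"
    "(g has_derivative (\<lambda>h. scaleC h E)) (at z within U)"
    using assms unfolding algebra_holomorphic_on_def by metis
  then have "((\<lambda>z. f z * g z) has_derivative (\<lambda>h. f z * scaleC h E + scaleC h D * g z)) (at z within U)"
    by (rule has_derivative_mult)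
  then show "\<exists>D. ((\<lambda>z. f z * g z) has_derivative (\<lambda>h. scaleC h D)) (at z within U)"
    unfolding scaleC_mult_left scaleC_mult_right scaleC_add_right[symmetric] by blast
qed

lemma algebra_holomorphic_on_scaleC:
  assumes "h holomorphic_on U"
  shows "algebra_holomorphic_on (\<lambda>z. scaleC (h z) c) U"
  unfolding algebra_holomorphic_on_def
proof
  fix z assume "z \<in> U"
  then obtain d where "(h has_field_derivative d) (at z within U)"
    using assms unfolding holomorphic_on_def field_differentiable_def by blast
  then have "((\<lambda>z. scaleC (h z) c) has_derivative (\<lambda>k. scaleC (d * k) c)) (at z within U)"
    unfolding has_field_derivative_def
    by (rule bounded_linear.has_derivative[OF scaleC.bounded_linear_left])
  then show "\<exists>D. ((\<lambda>z. scaleC (h z) c) has_derivative (\<lambda>h. scaleC h D)) (at z within U)"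
    by (intro exI[of _ "scaleC d c"]) (simp add: scaleC_scaleC mult.commute)
qed

lemma algebra_holomorphic_on_diff:
  assumes "algebra_holomorphic_on f U" "algebra_holomorphic_on g U"
  shows "algebra_holomorphic_on (\<lambda>z. f z - g z) U"
  unfolding algebra_holomorphic_on_def
proof
  fix z assume "z \<in> U"
  then obtain D E where "(f has_derivative (\<lambda>h. scaleC h D)) (at z within U)"
    "(g has_derivative (\<lambda>h. scaleC h E)) (at z within U)"
    using assms unfolding algebra_holomorphic_on_def by metis
  then have "((\<lambda>z. f z - g z) has_derivative (\<lambda>h. scaleC h D - scaleC h E)) (at z within U)"
    by (rule has_derivative_diff)
  then show "\<exists>D. ((\<lambda>z. f z - g z) has_derivative (\<lambda>h. scaleC h D)) (at z within U)"
    unfolding scaleC.diff_right[symmetric] by blast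
qed

lemma algebra_holomorphic_on_continuous:
  "algebra_holomorphic_on f U \<Longrightarrow> open U \<Longrightarrow> z \<in> U \<Longrightarrow> isCont f z"
  unfolding algebra_holomorphic_on_def
  by (metis at_within_open has_derivative_continuous)

text \<open>The resolvent identity alone gives local boundedness, then continuity, then holomorphy.\<close>

lemma resolvent_holomorphic:
  fixes r :: "complex \<Rightarrow> 'a::complex_unital_banach_algebra"
  assumes U: "open U"
    and res: "\<And>y z. y \<in> U \<Longrightarrow> z \<in> U \<Longrightarrow> r y - r z = scaleC (y - z) (r y * b * r z)"
  shows "algebra_holomorphic_on r U"
  unfolding algebra_holomorphic_on_def
proof
  fix z assume z: "z \<in> U"
  define K where "K = norm (b * r z)"
  have diff: "norm (r y - r z) \<le> cmod (y - z) * (norm (r y) * K)" if "y \<in> U" for y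
    unfolding res[OF that z] norm_scaleC K_def mult.assoc
    by (intro mult_left_mono norm_mult_ineq) auto
  have "eventually (\<lambda>y. y \<in> U) (at z)"
    using U z by (rule eventually_at_in_open')
  moreover have "((\<lambda>y. cmod (y - z) * K) \<longlongrightarrow> cmod (z - z) * K) (at z)"
    by (intro tendsto_intros)
  then have small: "((\<lambda>y. cmod (y - z) * K) \<longlongrightarrow> 0) (at z)" by simp
  \<comment> \<open>With the factor 1/2, the bound for \<open>r y - r z\<close> is absorbed by
    \<open>norm (r y)\<close>, leaving \<open>norm (r y) \<le> 2 * norm (r z)\<close>.\<close>
  then have "eventually (\<lambda>y. cmod (y - z) * K < 1 / 2) (at z)"
    by (rule order_tendstoD) simp
  ultimately have "eventually (\<lambda>y. norm (r y - r z) \<le> cmod (y - z) * K * (2 * norm (r z))) (at z)"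
  proof eventually_elim
    case (elim y)
    have "norm (r y) \<le> norm (r z) + norm (r y - r z)"
      by (metis norm_triangle_sub)
    also have "norm (r y - r z) \<le> (cmod (y - z) * K) * norm (r y)"
      using diff[OF elim(1)] by (simp add: ac_simps)
    also have "\<dots> \<le> 1 / 2 * norm (r y)"
      using elim(2) by (intro mult_right_mono) auto
    finally have "norm (r y) \<le> 2 * norm (r z)" by simp
    then have "cmod (y - z) * (norm (r y) * K) \<le> cmod (y - z) * (2 * norm (r z) * K)"
      by (intro mult_left_mono mult_right_mono) (auto simp: K_def)
    then show ?case using diff[OF elim(1)] by (simp add: ac_simps)
  qed
  moreover have "((\<lambda>y. cmod (y - z) * K * (2 * norm (r z))) \<longlongrightarrow> 0) (at z)"
    using tendsto_mult_left_zero[OF small] by simp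
  ultimately have lim: "((\<lambda>y. r y - r z) \<longlongrightarrow> 0) (at z)"
    by (rule Lim_null_comparison)
  have "((\<lambda>y. norm ((r y - r z) - scaleC (y - z) (r z * b * r z)) / norm (y - z)) \<longlongrightarrow> 0) (at z)"
  proof (rule Lim_null_comparison)
    show "eventually (\<lambda>y. norm (norm ((r y - r z) - scaleC (y - z) (r z * b * r z)) / norm (y - z))
        \<le> norm (r y - r z) * K) (at z)"
      using \<open>eventually (\<lambda>y. y \<in> U) (at z)\<close> eventually_neq_at_within[of z]
    proof eventually_elim
      case (elim y)
      have "(r y - r z) - scaleC (y - z) (r z * b * r z) = scaleC (y - z) ((r y - r z) * (b * r z))"
        by (subst res[OF elim(1) z]) (simp add: left_diff_distrib scaleC.diff_right mult.assoc)
      then show ?case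
        using elim(2) norm_mult_ineq[of "r y - r z" "b * r z"] by (simp add: norm_scaleC K_def)
    qed
    show "((\<lambda>y. norm (r y - r z) * K) \<longlongrightarrow> 0) (at z)"
      using tendsto_mult_left_zero[OF tendsto_norm_zero[OF lim]] .
  qed
  then have "(r has_derivative (\<lambda>h. scaleC h (r z * b * r z))) (at z)"
    unfolding has_derivative_iff_norm using scaleC.bounded_linear_left by blast
  then show "\<exists>D. (r has_derivative (\<lambda>h. scaleC h D)) (at z within U)"
    using has_derivative_at_withinI by blast
qed

lemma neumann_series:
  fixes c :: "'a::complex_unital_banach_algebra"
  assumes "norm c < 1"
  obtains r where "(1 - c) * r = 1" "r * (1 - c) = 1"
proof -
  \<comment> \<open>The norm of 1 may exceed 1, and the factor accounts for n = 0.\<close>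
  have le: "norm (c ^ n) \<le> norm (1::'a) * norm c ^ n" for n
  proof (induction n)
    case (Suc n)
    have "norm (c ^ Suc n) \<le> norm (c ^ n) * norm c"
      using norm_mult_ineq[of "c ^ n" c] by (simp add: power_Suc2 del: power_Suc)
    also have "\<dots> \<le> norm (1::'a) * norm c ^ n * norm c"
      using Suc by (intro mult_right_mono) auto
    finally show ?case by (simp add: ac_simps)
  qed simp
  have s: "summable (\<lambda>n. c ^ n)"
  proof (rule summable_comparison_test)
    show "\<exists>N. \<forall>n\<ge>N. norm (c ^ n) \<le> norm (1::'a) * norm c ^ n" using le by blast
    show "summable (\<lambda>n. norm (1::'a) * norm c ^ n)"
      using assms by (intro summable_mult summable_geometric) simp
  qed
  define r where "r = (\<Sum>n. c ^ n)"
  have "r = 1 + (\<Sum>n. c ^ Suc n)"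
    unfolding r_def using suminf_split_head[OF s] by simp
  moreover have "(\<Sum>n. c ^ Suc n) = c * r"
    unfolding r_def using suminf_mult[OF s, of c] by simp
  moreover have "(\<Sum>n. c ^ Suc n) = r * c"
    unfolding r_def using suminf_mult2[OF s, of c] by (simp add: power_Suc2 del: power_Suc)
  ultimately show thesis using that[of r] by (simp add: algebra_simps)
qed

lemma inverse_resolvent:
  fixes b :: "'a::complex_unital_banach_algebra"
  obtains r \<epsilon> where "0 < \<epsilon>" "algebra_holomorphic_on r (ball 0 \<epsilon>)"
    "\<And>z. z \<in> ball 0 \<epsilon> \<Longrightarrow> (1 - scaleC z b) * r z = 1"
    "\<And>z. z \<in> ball 0 \<epsilon> \<Longrightarrow> r z * (1 - scaleC z b) = 1"
proof -
  define \<epsilon> where "\<epsilon> = 1 / (norm b + 1)"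
  have pos: "0 < \<epsilon>" by (simp add: \<epsilon>_def add_nonneg_pos)
  have "\<exists>r. (1 - scaleC z b) * r = 1 \<and> r * (1 - scaleC z b) = 1" if "z \<in> ball 0 \<epsilon>" for z
  proof -
    have "cmod z < \<epsilon>" using that by simp
    then have "cmod z * (norm b + 1) < 1"
      using pos by (simp add: \<epsilon>_def field_simps add_nonneg_pos)
    then have "norm (scaleC z b) < 1"
      using norm_ge_zero[of z] unfolding norm_scaleC distrib_left by linarith
    then show ?thesis by (metis neumann_series)
  qed
  then obtain r where r: "\<And>z. z \<in> ball 0 \<epsilon> \<Longrightarrow> (1 - scaleC z b) * r z = 1"
    "\<And>z. z \<in> ball 0 \<epsilon> \<Longrightarrow> r z * (1 - scaleC z b) = 1"
    by metis
  have "r y - r z = scaleC (y - z) (r y * b * r z)" if "y \<in> ball 0 \<epsilon>" "z \<in> ball 0 \<epsilon>" for y z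
  proof -
    have "r y - r z = r y * ((1 - scaleC z b) * r z) - r y * (1 - scaleC y b) * r z"
      using r that by simp
    also have "\<dots> = r y * (scaleC (y - z) b) * r z"
      by (simp add: algebra_simps scaleC.diff_left)
    finally show ?thesis by (simp add: scaleC_mult_left scaleC_mult_right)
  qed
  then have "algebra_holomorphic_on r (ball 0 \<epsilon>)"
    by (intro resolvent_holomorphic) auto
  then show thesis using that pos r by blast
qed

section \<open>Finite dimensionality\<close>

interpretation CV: vector_space "scaleC :: complex \<Rightarrow> 'a::complex_unital_banach_algebra \<Rightarrow> 'a"
  by unfold_locales (auto simp: scaleC_add_left scaleC_add_right scaleC_scaleC scaleC_one)

text \<open>
  Gelfand--Mazur: otherwise the resolvent of \<open>z\<close> in the corner \<open>e A e\<close> would be entire and vanish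
  at infinity.
\<close>

lemma division_corner_scalar:
  fixes e z :: "'a::complex_unital_banach_algebra"
  assumes e: "e * e = e" "e \<noteq> 0"
    and inv: "\<And>y. e * y = y \<Longrightarrow> y * e = y \<Longrightarrow> y \<noteq> 0 \<Longrightarrow> \<exists>c. e * c = c \<and> c * e = c \<and> y * c = e"
    and z: "e * z = z" "z * e = z"
  shows "\<exists>l. z = scaleC l e"
proof (rule ccontr)
  assume contra: "\<nexists>l. z = scaleC l e"
  define y where "y l = z - scaleC l e" for l
  have y: "e * y l = y l" "y l * e = y l" "y l \<noteq> 0" for l
    using contra e z
    by (auto simp: y_def right_diff_distrib left_diff_distrib scaleC_mult_left scaleC_mult_right)
  then have "\<forall>l. \<exists>c. e * c = c \<and> c * e = c \<and> y l * c = e"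
    using inv by blast
  from choice[OF this] obtain r
    where r: "\<And>l. e * r l = r l" "\<And>l. r l * e = r l" "\<And>l. y l * r l = e"
    by blast
  have r0: "r l \<noteq> 0" for l using r(3)[of l] e by auto
  \<comment> \<open>A right inverse \<open>s\<close> of \<open>r l\<close> in the corner must equal
    \<open>y l\<close>, so the inverse is two-sided, as the resolvent identity requires.\<close>
  have ry: "r l * y l = e" for l
  proof -
    obtain s where s: "e * s = s" "r l * s = e" using inv[OF r(1,2) r0] by blast
    have "y l * e = e * s" using s(2) r(3)[of l] by (metis mult.assoc)
    then have "y l = s" using s(1) y(2) by metis
    then show ?thesis using s by simp
  qed
  have "r m - r l = scaleC (m - l) (r m * 1 * r l)" for l m
  proof -
    have "r m - r l = r m * (y l * r l) - r m * y m * r l"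
      by (simp add: r ry)
    also have "\<dots> = r m * (y l - y m) * r l" by (simp add: algebra_simps)
    also have "y l - y m = scaleC (m - l) e" by (simp add: y_def scaleC.diff_left)
    finally show ?thesis by (simp add: scaleC_mult_left scaleC_mult_right r)
  qed
  then have hol: "algebra_holomorphic_on r UNIV"
    by (intro resolvent_holomorphic[where b = 1]) auto
  obtain \<phi> where \<phi>: "cfunctional \<phi>" "\<phi> (r 0) \<noteq> 0" using cfunctional_exists[OF r0] .
  then obtain K where K: "\<And>x. cmod (\<phi> x) \<le> norm x * K" "0 < K"
    using bounded_linear.pos_bounded unfolding cfunctional_def by blast
  \<comment> \<open>The threshold gives \<open>norm z \<le> cmod l / 2\<close>, so half of the left
    side survives in l r = z r - e; the summand 1 keeps l away from 0.\<close>
  have decay: "norm (r l) \<le> 2 * norm e / cmod l" if l: "2 * norm z + 1 \<le> cmod l" for l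
  proof -
    have "z * r l - scaleC l (r l) = e"
      using r(1,3)[of l] by (simp add: y_def left_diff_distrib scaleC_mult_left)
    then have "scaleC l (r l) = z * r l - e" by (metis add_diff_cancel_left' diff_add_cancel)
    then have "cmod l * norm (r l) \<le> norm (z * r l) + norm e"
      using norm_triangle_ineq4[of "z * r l" e] by (simp flip: norm_scaleC)
    also have "norm (z * r l) \<le> norm z * norm (r l)" by (rule norm_mult_ineq)
    also have "\<dots> \<le> cmod l / 2 * norm (r l)"
      using l by (intro mult_right_mono) auto
    finally have "cmod l * norm (r l) \<le> 2 * norm e" by simp
    moreover have "0 < cmod l" using l norm_ge_zero[of z] by linarith
    ultimately show ?thesis by (simp add: field_simps)
  qed
  have "((\<lambda>l. \<phi> (r l)) \<longlongrightarrow> 0) at_infinity"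
  proof (rule Lim_null_comparison)
    show "eventually (\<lambda>l. norm (\<phi> (r l)) \<le> 2 * norm e * K / cmod l) at_infinity"
      unfolding eventually_at_infinity
    proof (intro exI allI impI)
      fix l :: complex assume "2 * norm z + 1 \<le> norm l"
      then have "norm (r l) * K \<le> 2 * norm e / cmod l * K"
        using decay K by (intro mult_right_mono) auto
      then show "norm (\<phi> (r l)) \<le> 2 * norm e * K / cmod l"
        using K(1)[of "r l"] by simp
    qed
    show "((\<lambda>l. 2 * norm e * K / cmod l) \<longlongrightarrow> 0) at_infinity"
      by (intro tendsto_divide_0[OF tendsto_const] filterlim_at_top_imp_at_infinity
          filterlim_norm_at_top)
  qed
  then have "\<phi> (r 0) = 0"
    by (rule Liouville_weak_0[OF cfunctional_holomorphic[OF hol \<phi>(1)]])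
  then show False using \<phi> by simp
qed

text \<open>The corner f A f is a division algebra, hence consists of scalar multiples of
  \<open>f\<close>. If \<open>z = e * a0 * f\<close> is nonzero, it generates \<open>M\<close>, so
  \<open>e = z * c\<close>, and every e a f equals z (f c e a f), a scalar multiple of
  \<open>z\<close>.\<close>

lemma minimal_corner:
  fixes M N :: "'a::complex_unital_banach_algebra set"
  assumes M: "minimal_right_ideal M" "e \<in> M" "e \<noteq> 0" "\<And>m. m \<in> M \<Longrightarrow> e * m = m"
    and N: "minimal_right_ideal N" "f \<in> N" "f \<noteq> 0" "\<And>m. m \<in> N \<Longrightarrow> f * m = m"
  shows "\<exists>z. \<forall>a. e * a * f \<in> CV.span {z}"
proof -
  have gen: "\<exists>c. y * c = e'"
    if M: "minimal_right_ideal M" "e' \<in> M" "y \<in> M" "y \<noteq> 0" for e' y :: 'a and M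
  proof -
    have "range ((*) y) \<subseteq> M" using minimal_right_idealD(1)[OF M(1)] M(3) by (auto simp: right_ideal_iff)
    moreover have "range ((*) y) \<noteq> {0}" using M(4) by (metis mult.right_neutral rangeI singletonD)
    ultimately have "range ((*) y) = M"
      by (intro minimal_right_idealD(3)[OF M(1) right_ideal_range])
    then show ?thesis using M(2) by (metis imageE)
  qed
  have inM: "e * x \<in> M" and inN: "f * x \<in> N" for x
    using minimal_right_idealD(1)[OF M(1)] minimal_right_idealD(1)[OF N(1)] M(2) N(2)
    by (auto simp: right_ideal_iff)
  have ee: "e * e = e" and ff: "f * f = f" using M N by auto
  have "\<exists>c. f * c = c \<and> c * f = c \<and> y * c = f" if y: "f * y = y" "y * f = y" "y \<noteq> 0" for y
  proof -
    have "y \<in> N" using inN[of y] y by simp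
    then obtain c where c: "y * c = f" using gen[OF N(1,2)] y by blast
    \<comment> \<open>The right inverse \<open>c\<close> found in the algebra is compressed into the
      corner.\<close>
    have "y * (f * c * f) = y * f * c * f" by (simp add: mult.assoc)
    also have "\<dots> = f" using y(2) c ff by simp
    finally show ?thesis
      by (intro exI[of _ "f * c * f"]) (simp add: ff mult.assoc flip: mult.assoc[of f f])
  qed
  note scalar = division_corner_scalar[OF ff N(3) this]
  show ?thesis
  proof (cases "\<forall>a. e * a * f = 0")
    case True
    then show ?thesis by (auto intro: CV.span_zero)
  next
    case False
    then obtain a0 where a0: "e * a0 * f \<noteq> 0" by blast
    define z where "z = e * a0 * f"
    have "z \<in> M" using inM[of "a0 * f"] by (simp add: z_def mult.assoc)
    then obtain c where c: "z * c = e" using gen[OF M(1,2)] a0 by (metis z_def)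
    have zf: "z * f = z" by (simp add: z_def mult.assoc ff)
    have "e * a * f \<in> CV.span {z}" for a
    proof -
      define w where "w = f * c * (e * a * f)"
      have "f * w = w" "w * f = w"
        by (simp_all add: w_def mult.assoc ff flip: mult.assoc[of f f])
      then obtain l where l: "w = scaleC l f" using scalar by blast
      have "e * a * f = e * (e * a * f)" by (simp add: ee flip: mult.assoc)
      also have "\<dots> = z * w"
        using c zf unfolding w_def by (metis mult.assoc)
      also have "\<dots> = scaleC l z" by (simp add: l scaleC_mult_right zf)
      finally show ?thesis by (simp add: CV.span_scale CV.span_base)
    qed
    then show ?thesis by blast
  qed
qed

text \<open>Each summand of \<open>s\<close> and \<open>t\<close> absorbs the left unit of its
  minimal right ideal, so f J a g K lies in (d A e) g K, of dimension at most one. \<open>T\<close>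
  has one generator per pair of summands.\<close>

lemma socle_sandwich_finite_dim:
  fixes s t :: "'a::complex_unital_banach_algebra"
  assumes sp: "semiprime TYPE('a)" and s: "s \<in> socle" and t: "t \<in> socle"
  obtains T where "finite T" "\<And>a. s * a * t \<in> CV.span T"
proof -
  obtain F f where F: "finite F" "\<forall>J\<in>F. minimal_right_ideal J \<and> f J \<in> J" and sf: "s = sum f F"
    using s by (auto simp: socle_def)
  obtain G g where G: "finite G" "\<forall>J\<in>G. minimal_right_ideal J \<and> g J \<in> J" and tg: "t = sum g G"
    using t by (auto simp: socle_def)
  have "\<exists>w. \<forall>a. f J * a * g K \<in> CV.span {w}" if "J \<in> F" "K \<in> G" for J K
  proof -
    have J: "minimal_right_ideal J" "f J \<in> J" and K: "minimal_right_ideal K" "g K \<in> K"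
      using F(2) G(2) that by auto
    obtain d where d: "d \<in> J" "d \<noteq> 0" "\<And>m. m \<in> J \<Longrightarrow> d * m = m"
      using minimal_right_ideal_idempotent[OF sp J(1)] by blast
    obtain e where e: "e \<in> K" "e \<noteq> 0" "\<And>m. m \<in> K \<Longrightarrow> e * m = m"
      using minimal_right_ideal_idempotent[OF sp K(1)] by blast
    obtain z where z: "\<And>a. d * a * e \<in> CV.span {z}"
      using minimal_corner[OF J(1) d K(1) e] by blast
    have "f J * a * g K \<in> CV.span {z * g K}" for a
    proof -
      obtain l where l: "d * (f J * a) * e = scaleC l z"
        using z[of "f J * a"] by (auto simp: CV.span_singleton)
      have "f J * a * g K = d * (f J * a) * e * g K"
        using d(3)[OF J(2)] e(3)[OF K(2)] by (metis mult.assoc)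
      also have "\<dots> = scaleC l (z * g K)" by (simp add: l scaleC_mult_left)
      finally show ?thesis by (simp add: CV.span_scale CV.span_base)
    qed
    then show ?thesis by blast
  qed
  then have "\<forall>p\<in>F \<times> G. \<exists>w. \<forall>a. f (fst p) * a * g (snd p) \<in> CV.span {w}"
    by auto
  from bchoice[OF this] obtain w
    where w: "\<And>J K a. J \<in> F \<Longrightarrow> K \<in> G \<Longrightarrow> f J * a * g K \<in> CV.span {w (J, K)}"
    by fastforce
  define T where "T = w ` (F \<times> G)"
  have "s * a * t \<in> CV.span T" for a
  proof -
    have "s * a * t = (\<Sum>J\<in>F. \<Sum>K\<in>G. f J * a * g K)"
      by (simp add: sf tg sum_distrib_right sum_distrib_left) (rule sum.swap)
    moreover have "f J * a * g K \<in> CV.span T" if "J \<in> F" "K \<in> G" for J K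
      using w[OF that, of a] CV.span_mono[of "{w (J, K)}" T] that by (auto simp: T_def)
    ultimately show ?thesis by (auto intro!: CV.span_sum)
  qed
  moreover have "finite T" using F(1) G(1) by (simp add: T_def)
  ultimately show thesis using that by blast
qed

section \<open>Holomorphic families of linear maps\<close>

text \<open>On a connected domain a function that is nonzero somewhere vanishes at 0 to finite order
  \<open>m\<close>. Half the modulus of the cofactor at 0 serves as \<delta>.\<close>

lemma holomorphic_lower_bound:
  fixes p :: "complex \<Rightarrow> complex"
  assumes p: "p holomorphic_on D" and D: "open D" "connected D" "0 \<in> D"
    and z0: "z0 \<in> D" "p z0 \<noteq> 0"
  obtains m \<delta> where "0 < \<delta>" "eventually (\<lambda>z. \<delta> * cmod z ^ m \<le> cmod (p z)) (at 0)"
proof (cases "p 0 = 0")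
  case False
  have "continuous_on D p" using p by (rule holomorphic_on_imp_continuous_on)
  then have "isCont p 0" using D by (simp add: continuous_on_eq_continuous_at)
  then have "((\<lambda>z. cmod (p z)) \<longlongrightarrow> cmod (p 0)) (at 0)"
    by (intro tendsto_norm) (simp add: isCont_def)
  then have "eventually (\<lambda>z. cmod (p 0) / 2 < cmod (p z)) (at 0)"
    using False by (intro order_tendstoD) auto
  then have "eventually (\<lambda>z. cmod (p 0) / 2 * cmod z ^ 0 \<le> cmod (p z)) (at 0)"
    by eventually_elim simp
  then show thesis using False by (intro that[of "cmod (p 0) / 2" 0]) auto
next
  case True
  have "\<not> p constant_on D"
    using z0 True D(3) unfolding constant_on_def by metis
  then obtain g r n where g: "0 < r" "ball 0 r \<subseteq> D" "g holomorphic_on ball 0 r"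
    "\<And>w. w \<in> ball 0 r \<Longrightarrow> p w = (w - 0) ^ n * g w" "\<And>w. w \<in> ball 0 r \<Longrightarrow> g w \<noteq> 0"
    using holomorphic_factor_zero_nonconstant[OF p D True] by metis
  have "continuous_on (ball 0 r) g" using g(3) by (rule holomorphic_on_imp_continuous_on)
  then have "isCont g 0" using g(1) by (simp add: continuous_on_eq_continuous_at)
  then have lim: "((\<lambda>z. cmod (g z)) \<longlongrightarrow> cmod (g 0)) (at 0)"
    by (intro tendsto_norm) (simp add: isCont_def)
  have g0: "g 0 \<noteq> 0" using g(1,5) by simp
  then have "eventually (\<lambda>z. cmod (g 0) / 2 < cmod (g z)) (at 0)"
    using lim by (intro order_tendstoD) auto
  moreover have "eventually (\<lambda>z. z \<in> ball 0 r) (at 0)"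
    using g(1) by (intro eventually_at_in_open') auto
  ultimately have "eventually (\<lambda>z. cmod (g 0) / 2 * cmod z ^ n \<le> cmod (p z)) (at 0)"
  proof eventually_elim
    case (elim z)
    have "cmod (g 0) / 2 * cmod z ^ n \<le> cmod (g z) * cmod z ^ n"
      using elim(1) by (intro mult_right_mono) auto
    then show ?case using g(4)[OF elim(2)] by (simp add: norm_mult norm_power mult.commute)
  qed
  then show thesis using g0 by (intro that[of "cmod (g 0) / 2" n]) auto
qed

text \<open>
  Gaussian elimination over the field of meromorphic functions: the pivot \<open>\<phi> (c b z)\<close> clears the
  column \<open>b\<close> from the others, and its order of vanishing at \<open>0\<close> is added to the exponent \<open>m\<close>.
\<close>

lemma holomorphic_columns:
  fixes c :: "'b \<Rightarrow> complex \<Rightarrow> 'a::complex_unital_banach_algebra"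
  assumes "finite B" and D: "open D" "connected D" "0 \<in> D"
    and "\<And>v \<phi>. v \<in> B \<Longrightarrow> cfunctional \<phi> \<Longrightarrow> (\<lambda>z. \<phi> (c v z)) holomorphic_on D"
    and "\<And>v. v \<in> B \<Longrightarrow> isCont (c v) 0"
  shows "(\<exists>h. (\<forall>v\<in>B. h v holomorphic_on D) \<and> (\<exists>v\<in>B. \<exists>z\<in>D. h v z \<noteq> 0) \<and>
            (\<forall>z\<in>D. (\<Sum>v\<in>B. scaleC (h v z) (c v z)) = 0)) \<or>
         (\<exists>m C. 0 \<le> C \<and> eventually (\<lambda>z. \<forall>\<alpha>. \<forall>v\<in>B.
            cmod z ^ m * cmod (\<alpha> v) \<le> C * norm (\<Sum>w\<in>B. scaleC (\<alpha> w) (c w z))) (at 0))"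
  using assms(1,5,6)
proof (induction B arbitrary: c rule: finite_induct)
  case empty
  then show ?case by (intro disjI2 exI[of _ 0]) auto
next
  case (insert b B)
  show ?case
  proof (cases "\<forall>z\<in>D. c b z = 0")
    case True
    have "(\<Sum>v\<in>insert b B. scaleC (if v = b then 1 else 0) (c v z)) = 0" if "z \<in> D" for z
      using True that insert.hyps by (auto simp: scaleC.zero_left intro!: sum.neutral)
    then show ?thesis
      using D(3) by (intro disjI1 exI[of _ "\<lambda>v z. if v = b then 1 else 0"]) auto
  next
    case False
    then obtain z0 where z0: "z0 \<in> D" "c b z0 \<noteq> 0" by blast
    obtain \<phi> where \<phi>: "cfunctional \<phi>" "\<phi> (c b z0) \<noteq> 0" using cfunctional_exists[OF z0(2)] .
    then interpret \<phi>: bounded_linear \<phi> by (simp add: cfunctional_def)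
    have \<phi>s: "\<phi> (scaleC l x) = l * \<phi> x" for l x using \<phi>(1) by (simp add: cfunctional_def)
    define p where "p z = \<phi> (c b z)" for z
    define q where "q v z = \<phi> (c v z)" for v z
    \<comment> \<open>Cross multiplication instead of division by the pivot keeps the new columns
      holomorphic, also where \<open>p\<close> vanishes; \<open>\<phi>\<close> kills all of
      them.\<close>
    define c' where "c' v z = scaleC (p z) (c v z) - scaleC (q v z) (c b z)" for v z
    have hp: "p holomorphic_on D" unfolding p_def using insert.prems(1) \<phi>(1) by blast
    have hq: "q v holomorphic_on D" if "v \<in> B" for v
      unfolding q_def using insert.prems(1) \<phi>(1) that by blast
    obtain m1 \<delta> where \<delta>: "0 < \<delta>" "eventually (\<lambda>z. \<delta> * cmod z ^ m1 \<le> cmod (p z)) (at 0)"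
      using holomorphic_lower_bound[OF hp D z0(1)] \<phi>(2) unfolding p_def by blast
    have inD: "eventually (\<lambda>z. z \<in> D) (at 0)" using D(1,3) by (rule eventually_at_in_open')
    have nz: "eventually (\<lambda>z::complex. z \<noteq> 0) (at 0)" by (rule eventually_neq_at_within)
    have hol': "(\<lambda>z. \<psi> (c' v z)) holomorphic_on D" if "v \<in> B" "cfunctional \<psi>" for v \<psi>
    proof -
      have \<psi>: "\<psi> (x - y) = \<psi> x - \<psi> y" "\<psi> (scaleC l x) = l * \<psi> x" for x y l
        using that(2) by (auto simp: cfunctional_def linear_simps)
      have "(\<lambda>z. \<psi> (c v z)) holomorphic_on D" "(\<lambda>z. \<psi> (c b z)) holomorphic_on D"
        using insert.prems(1) that by auto
      then show ?thesis unfolding c'_def \<psi> using that(1)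
        by (intro holomorphic_intros hp hq)
    qed
    have cont': "isCont (c' v) 0" if "v \<in> B" for v
    proof -
      have "isCont p 0" "isCont (q v) 0"
        using holomorphic_on_imp_continuous_on[OF hp] holomorphic_on_imp_continuous_on[OF hq[OF that]] D
        by (auto simp: continuous_on_eq_continuous_at)
      moreover have "isCont (c v) 0" "isCont (c b) 0" using insert.prems(2) that by auto
      ultimately show ?thesis
        unfolding c'_def isCont_def by (intro tendsto_intros scaleC.tendsto)
    qed
    have "(\<exists>h. (\<forall>v\<in>B. h v holomorphic_on D) \<and> (\<exists>v\<in>B. \<exists>z\<in>D. h v z \<noteq> 0) \<and>
          (\<forall>z\<in>D. (\<Sum>v\<in>B. scaleC (h v z) (c' v z)) = 0)) \<or>
        (\<exists>m C. 0 \<le> C \<and> eventually (\<lambda>z. \<forall>\<alpha>. \<forall>v\<in>B.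
          cmod z ^ m * cmod (\<alpha> v) \<le> C * norm (\<Sum>w\<in>B. scaleC (\<alpha> w) (c' w z))) (at 0))"
      by (rule insert.IH) (use hol' cont' in auto)
    then consider
      (rel) h where "\<forall>v\<in>B. h v holomorphic_on D" "\<exists>v\<in>B. \<exists>z\<in>D. h v z \<noteq> 0"
        "\<forall>z\<in>D. (\<Sum>v\<in>B. scaleC (h v z) (c' v z)) = 0"
    | (est) m C where "0 \<le> C" "eventually (\<lambda>z. \<forall>\<alpha>. \<forall>v\<in>B.
            cmod z ^ m * cmod (\<alpha> v) \<le> C * norm (\<Sum>w\<in>B. scaleC (\<alpha> w) (c' w z))) (at 0)"
      by blast
    then show ?thesis
    proof cases
      case rel
      \<comment> \<open>Expanding \<open>c'\<close> in the relation gives \<open>c v\<close> the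
        coefficient \<open>h v * p\<close>, while \<open>c b\<close> collects all the
        \<open>q\<close> terms.\<close>
      define h' where "h' v = (if v = b then (\<lambda>z. - (\<Sum>w\<in>B. h w z * q w z)) else (\<lambda>z. h v z * p z))" for v
      have "h' v holomorphic_on D" if "v \<in> insert b B" for v
        using that rel(1) hp hq by (cases "v = b") (auto simp: h'_def intro!: holomorphic_intros)
      moreover have "\<exists>v\<in>insert b B. \<exists>z\<in>D. h' v z \<noteq> 0"
      proof -
        obtain v z1 where v: "v \<in> B" "z1 \<in> D" "h v z1 \<noteq> 0" using rel(2) by blast
        obtain m2 \<eta> where \<eta>: "0 < \<eta>" "eventually (\<lambda>z. \<eta> * cmod z ^ m2 \<le> cmod (h v z)) (at 0)"
          using holomorphic_lower_bound[of "h v", OF _ D v(2,3)] rel(1) v(1) by blast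
        \<comment> \<open>\<open>p\<close> and \<open>h v\<close> are known to be nonzero at
          possibly different points only; near 0, off 0, both are nonzero.\<close>
        have "eventually (\<lambda>z. z \<in> D \<and> h' v z \<noteq> 0) (at 0)"
          using \<delta>(2) \<eta>(2) inD nz
        proof eventually_elim
          case (elim z)
          have "0 < \<delta> * cmod z ^ m1" "0 < \<eta> * cmod z ^ m2" using \<delta>(1) \<eta>(1) elim(4) by auto
          then have "p z \<noteq> 0" "h v z \<noteq> 0" using elim(1,2) by auto
          then show ?case using v(1) insert.hyps elim(3) by (auto simp: h'_def)
        qed
        then obtain z where "z \<in> D" "h' v z \<noteq> 0"
          using eventually_happens'[OF at_neq_bot] by blast
        then show ?thesis using v(1) by blast
      qed
      moreover have "(\<Sum>v\<in>insert b B. scaleC (h' v z) (c v z)) = 0" if "z \<in> D" for z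
      proof -
        have "(\<Sum>v\<in>insert b B. scaleC (h' v z) (c v z)) =
            scaleC (h' b z) (c b z) + (\<Sum>v\<in>B. scaleC (h v z * p z) (c v z))"
          using insert.hyps by (auto simp: h'_def intro!: sum.cong)
        also have "scaleC (h' b z) (c b z) = - (\<Sum>v\<in>B. scaleC (h v z * q v z) (c b z))"
          by (simp add: h'_def scaleC.minus_left scaleC.sum_left)
        also have "- (\<Sum>v\<in>B. scaleC (h v z * q v z) (c b z)) + (\<Sum>v\<in>B. scaleC (h v z * p z) (c v z)) =
            (\<Sum>v\<in>B. scaleC (h v z) (c' v z))"
          by (simp add: c'_def scaleC.diff_right scaleC_scaleC sum_subtractf)
        also have "\<dots> = 0" using rel(3) that by blast
        finally show ?thesis .
      qed
      ultimately show ?thesis by (intro disjI1 exI[of _ h']) blast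
    next
      case est
      obtain K where K: "\<And>x. cmod (\<phi> x) \<le> norm x * K" "0 < K" using \<phi>.pos_bounded by blast
      define G where "G v = norm (c v 0) + 1" for v
      have G0: "0 \<le> G v" for v by (simp add: G_def)
      have Gb: "eventually (\<lambda>z. \<forall>v\<in>insert b B. norm (c v z) \<le> G v) (at 0)"
      proof (rule eventually_ball_finite)
        show "\<forall>v\<in>insert b B. eventually (\<lambda>z. norm (c v z) \<le> G v) (at 0)"
        proof
          fix v assume "v \<in> insert b B"
          then have "((\<lambda>z. norm (c v z)) \<longlongrightarrow> norm (c v 0)) (at 0)"
            using insert.prems(2) by (intro tendsto_norm) (simp add: isCont_def)
          then have "eventually (\<lambda>z. norm (c v z) < G v) (at 0)"
            by (rule order_tendstoD) (simp add: G_def)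
          then show "eventually (\<lambda>z. norm (c v z) \<le> G v) (at 0)"
            by eventually_elim simp
        qed
      qed (use insert.hyps in simp)
      \<comment> \<open>\<open>C1\<close> is the inductive bound in terms of the full combination
        \<open>y\<close>. \<open>C2\<close> results from solving \<open>\<phi> y\<close> for the
        coefficient of column \<open>b\<close>, where one divides by \<open>p z\<close>, of modulus
        at least \<delta> |z|^m1.\<close>
      define C1 where "C1 = C * (2 * K * G b)"
      define C2 where "C2 = (K + (\<Sum>v\<in>B. C1 * (K * G v))) / \<delta>"
      have C1: "0 \<le> C1" using est(1) K(2) G0 by (simp add: C1_def)
      \<comment> \<open>For |z| < 1, raising the exponent to \<open>m + m1\<close> only weakens the
        bounds.\<close>
      have small: "eventually (\<lambda>z. cmod z < 1) (at 0)"
        using eventually_at_in_open'[of "ball 0 1" "0 :: complex"] by simp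
      have "eventually (\<lambda>z. \<forall>\<alpha>. \<forall>v\<in>insert b B. cmod z ^ (m + m1) * cmod (\<alpha> v) \<le>
          max C1 C2 * norm (\<Sum>w\<in>insert b B. scaleC (\<alpha> w) (c w z))) (at 0)"
        using est(2) \<delta>(2) Gb small
      proof eventually_elim
        case (elim z)
        show ?case
        proof (intro allI ballI)
          fix \<alpha> :: "'b \<Rightarrow> complex" and v assume v: "v \<in> insert b B"
          define y where "y = (\<Sum>w\<in>insert b B. scaleC (\<alpha> w) (c w z))"
          have y: "y = scaleC (\<alpha> b) (c b z) + (\<Sum>w\<in>B. scaleC (\<alpha> w) (c w z))"
            using insert.hyps by (simp add: y_def)
          have \<phi>y: "\<phi> y = \<alpha> b * p z + (\<Sum>w\<in>B. \<alpha> w * q w z)"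
            by (simp add: y \<phi>.add \<phi>.sum \<phi>s p_def q_def)
          \<comment> \<open>The contributions of \<open>\<alpha> b\<close> cancel, so the
            combination of the cleared columns depends on \<open>y\<close> alone.\<close>
          have "(\<Sum>w\<in>B. scaleC (\<alpha> w) (c' w z)) = scaleC (p z) y - scaleC (\<phi> y) (c b z)"
          proof -
            have "(\<Sum>w\<in>B. scaleC (\<alpha> w) (c' w z)) =
                scaleC (p z) (\<Sum>w\<in>B. scaleC (\<alpha> w) (c w z)) - scaleC (\<Sum>w\<in>B. \<alpha> w * q w z) (c b z)"
              by (simp add: c'_def scaleC.diff_right scaleC_scaleC sum_subtractf scaleC.sum_right
                  scaleC.sum_left mult.commute)
            then show ?thesis
              unfolding \<phi>y unfolding y by (simp add: scaleC_add_left scaleC_add_right scaleC_scaleC mult.commute)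
          qed
          also have "norm \<dots> \<le> cmod (p z) * norm y + cmod (\<phi> y) * norm (c b z)"
            using norm_triangle_ineq4 by (metis norm_scaleC)
          also have "\<dots> \<le> (G b * K) * norm y + (norm y * K) * G b"
          proof (intro add_mono mult_mono)
            have "cmod (p z) \<le> norm (c b z) * K" unfolding p_def by (rule K(1))
            also have "\<dots> \<le> G b * K" using elim(3) K(2) by (intro mult_right_mono) auto
            finally show "cmod (p z) \<le> G b * K" .
          qed (use elim(3) K G0 in auto)
          finally have cy: "norm (\<Sum>w\<in>B. scaleC (\<alpha> w) (c' w z)) \<le> 2 * K * G b * norm y"
            by (simp add: ac_simps)
          have old: "cmod z ^ m * cmod (\<alpha> w) \<le> C1 * norm y" if "w \<in> B" for w
          proof -
            have "cmod z ^ m * cmod (\<alpha> w) \<le> C * norm (\<Sum>w\<in>B. scaleC (\<alpha> w) (c' w z))"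
              using elim(1) that by blast
            also have "\<dots> \<le> C * (2 * K * G b * norm y)" using cy est(1) by (rule mult_left_mono)
            finally show ?thesis by (simp add: C1_def ac_simps)
          qed
          have pw: "cmod z ^ j \<le> 1" for j using elim(4) by (simp add: power_le_one)
          show "cmod z ^ (m + m1) * cmod (\<alpha> v) \<le>
              max C1 C2 * norm (\<Sum>w\<in>insert b B. scaleC (\<alpha> w) (c w z))"
            unfolding y_def[symmetric]
          proof (cases "v = b")
            case False
            have "cmod z ^ (m + m1) * cmod (\<alpha> v) = cmod z ^ m1 * (cmod z ^ m * cmod (\<alpha> v))"
              by (simp add: power_add)
            also have "\<dots> \<le> 1 * (C1 * norm y)"
              by (rule mult_mono) (use pw old[of v] v False C1 in auto)
            also have "\<dots> \<le> max C1 C2 * norm y" by (simp add: mult_right_mono)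
            finally show "cmod z ^ (m + m1) * cmod (\<alpha> v) \<le> max C1 C2 * norm y" .
          next
            case True
            have "cmod (p z) * cmod (\<alpha> b) = cmod (\<phi> y - (\<Sum>w\<in>B. \<alpha> w * q w z))"
              by (simp add: \<phi>y norm_mult)
            also have "\<dots> \<le> cmod (\<phi> y) + (\<Sum>w\<in>B. cmod (\<alpha> w * q w z))"
              by (rule order_trans[OF norm_triangle_ineq4 add_left_mono[OF norm_sum]])
            finally have pb: "cmod (p z) * cmod (\<alpha> b) \<le> cmod (\<phi> y) + (\<Sum>w\<in>B. cmod (\<alpha> w * q w z))" .
            have "\<delta> * (cmod z ^ (m + m1) * cmod (\<alpha> b)) = cmod z ^ m * ((\<delta> * cmod z ^ m1) * cmod (\<alpha> b))"
              by (simp add: power_add)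
            also have "\<dots> \<le> cmod z ^ m * (cmod (p z) * cmod (\<alpha> b))"
              using elim(2) by (intro mult_left_mono mult_right_mono) auto
            also have "\<dots> \<le> cmod z ^ m * (cmod (\<phi> y) + (\<Sum>w\<in>B. cmod (\<alpha> w * q w z)))"
              using pb by (rule mult_left_mono) simp
            also have "cmod z ^ m * (cmod (\<phi> y) + (\<Sum>w\<in>B. cmod (\<alpha> w * q w z))) =
                cmod z ^ m * cmod (\<phi> y) + (\<Sum>w\<in>B. (cmod z ^ m * cmod (\<alpha> w)) * cmod (q w z))"
              by (simp add: distrib_left sum_distrib_left norm_mult mult.assoc)
            also have "\<dots> \<le> 1 * (norm y * K) + (\<Sum>w\<in>B. (C1 * norm y) * (K * G w))"
            proof (rule add_mono)
              show "cmod z ^ m * cmod (\<phi> y) \<le> 1 * (norm y * K)"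
                by (rule mult_mono) (use pw K in auto)
              show "(\<Sum>w\<in>B. (cmod z ^ m * cmod (\<alpha> w)) * cmod (q w z)) \<le>
                  (\<Sum>w\<in>B. (C1 * norm y) * (K * G w))"
              proof (rule sum_mono)
                fix w assume w: "w \<in> B"
                have "cmod (q w z) \<le> norm (c w z) * K" unfolding q_def by (rule K(1))
                also have "\<dots> \<le> G w * K" using elim(3) w K(2) by (intro mult_right_mono) auto
                finally have "cmod (q w z) \<le> K * G w" by (simp add: mult.commute)
                with old[OF w] show
                  "(cmod z ^ m * cmod (\<alpha> w)) * cmod (q w z) \<le> (C1 * norm y) * (K * G w)"
                  by (rule mult_mono) (use C1 in auto)
              qed
            qed
            also have "\<dots> = (K + (\<Sum>v\<in>B. C1 * (K * G v))) * norm y"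
              unfolding distrib_right sum_distrib_right by (simp add: mult_ac)
            also have "\<dots> = \<delta> * (C2 * norm y)"
              using \<delta>(1) by (simp add: C2_def)
            finally have "cmod z ^ (m + m1) * cmod (\<alpha> b) \<le> C2 * norm y"
              using \<delta>(1) by simp
            also have "\<dots> \<le> max C1 C2 * norm y" by (simp add: mult_right_mono)
            finally show "cmod z ^ (m + m1) * cmod (\<alpha> v) \<le> max C1 C2 * norm y"
              using True by simp
          qed
        qed
      qed
      moreover have "0 \<le> max C1 C2" using C1 by simp
      ultimately show ?thesis by blast
    qed
  qed
qed

text \<open>The columns are \<open>v * P z\<close> for \<open>v\<close> in a basis \<open>B\<close>
  of the span of \<open>V\<close>. A holomorphic relation with coefficients h v yields the kernel
  function f = \<Sum> h v v, nonzero by independence; bounds on coordinates become bounds on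
  norms.\<close>

lemma holomorphic_kernel_or_estimate:
  fixes P :: "complex \<Rightarrow> 'a::complex_unital_banach_algebra"
  assumes P: "algebra_holomorphic_on P D" and D: "open D" "connected D" "0 \<in> D"
    and V: "V \<subseteq> CV.span T" "finite T"
  shows "(\<exists>f. algebra_holomorphic_on f D \<and> (\<exists>z\<in>D. f z \<noteq> 0) \<and> (\<forall>z\<in>D. f z * P z = 0)) \<or>
         (\<exists>m C. 0 \<le> C \<and> eventually (\<lambda>z. \<forall>w\<in>V. cmod z ^ m * norm w \<le> C * norm (w * P z)) (at 0))"
proof -
  obtain B where B: "B \<subseteq> V" "CV.independent B" "V \<subseteq> CV.span B"
    using CV.maximal_independent_subset .
  have fB: "finite B" using CV.independent_span_bound[OF V(2) B(2)] B(1) V(1) by blast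
  define c where "c v z = v * P z" for v z
  have c: "algebra_holomorphic_on (c v) D" for v
    unfolding c_def by (intro algebra_holomorphic_on_mult algebra_holomorphic_on_const P)
  have sum_c: "(\<Sum>v\<in>B. scaleC (\<alpha> v) (c v z)) = (\<Sum>v\<in>B. scaleC (\<alpha> v) v) * P z" for \<alpha> z
    by (simp add: c_def sum_distrib_right scaleC_mult_left)
  from holomorphic_columns[of B D c, OF fB D cfunctional_holomorphic[OF c]
      algebra_holomorphic_on_continuous[OF c D(1,3)]]
  consider
      (rel) h where "\<forall>v\<in>B. h v holomorphic_on D" "\<exists>v\<in>B. \<exists>z\<in>D. h v z \<noteq> 0"
        "\<forall>z\<in>D. (\<Sum>v\<in>B. scaleC (h v z) (c v z)) = 0"
    | (est) m C where "0 \<le> C" "eventually (\<lambda>z. \<forall>\<alpha>. \<forall>v\<in>B.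
            cmod z ^ m * cmod (\<alpha> v) \<le> C * norm (\<Sum>w\<in>B. scaleC (\<alpha> w) (c w z))) (at 0)"
    by blast
  then show ?thesis
  proof cases
    case rel
    define f where "f z = (\<Sum>v\<in>B. scaleC (h v z) v)" for z
    have "algebra_holomorphic_on f D"
      unfolding f_def using rel(1) by (intro algebra_holomorphic_on_sum algebra_holomorphic_on_scaleC) auto
    moreover have "\<exists>z\<in>D. f z \<noteq> 0"
    proof -
      obtain v z1 where "v \<in> B" "z1 \<in> D" "h v z1 \<noteq> 0" using rel(2) by blast
      then show ?thesis
        using CV.independentD[OF B(2) fB subset_refl, of "\<lambda>v. h v z1" v] unfolding f_def by blast
    qed
    ultimately show ?thesis
      using rel(3) unfolding sum_c f_def[symmetric] by blast
  next
    case est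
    define C' where "C' = C * (\<Sum>v\<in>B. norm v)"
    have "eventually (\<lambda>z. \<forall>w\<in>V. cmod z ^ m * norm w \<le> C' * norm (w * P z)) (at 0)"
      using est(2)
    proof eventually_elim
      case (elim z)
      show ?case
      proof
        fix w assume "w \<in> V"
        then obtain \<alpha> where w: "w = (\<Sum>v\<in>B. scaleC (\<alpha> v) v)"
          using B(3) CV.span_finite[OF fB] by blast
        have "cmod z ^ m * norm w \<le> cmod z ^ m * (\<Sum>v\<in>B. norm (scaleC (\<alpha> v) v))"
          unfolding w by (intro mult_left_mono norm_sum) auto
        also have "\<dots> = (\<Sum>v\<in>B. (cmod z ^ m * cmod (\<alpha> v)) * norm v)"
          by (simp add: sum_distrib_left norm_scaleC mult.assoc)
        also have "\<dots> \<le> (\<Sum>v\<in>B. (C * norm (w * P z)) * norm v)"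
          using elim[rule_format, of _ \<alpha>] unfolding sum_c w[symmetric]
          by (intro sum_mono mult_right_mono) auto
        also have "\<dots> = C' * norm (w * P z)"
          by (simp add: C'_def sum_distrib_left sum_distrib_right ac_simps)
        finally show "cmod z ^ m * norm w \<le> C' * norm (w * P z)" .
      qed
    qed
    moreover have "0 \<le> C'" using est(1) by (simp add: C'_def sum_nonneg)
    ultimately show ?thesis by blast
  qed
qed

section \<open>Local behaviour at a B-Fredholm point\<close>

lemma socle_scaleC: "s \<in> socle \<Longrightarrow> scaleC l (s :: 'a::complex_unital_banach_algebra) \<in> socle"
  using socle_mult_right[of s "scaleC l 1"] by (simp add: scaleC_mult_right)

text \<open>A right inverse modulo the socle makes \<open>y\<close> regular, and
  \<open>y * g * y = y\<close> exhibits \<open>1 - y * g\<close> as a left annihilator of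
  \<open>y\<close>.\<close>

lemma regular_right_inverse:
  fixes y :: "'a::ring_1"
  assumes sp: "semiprime TYPE('a)" and y: "1 - y * G \<in> socle"
    and ann: "\<And>c. c * y = 0 \<Longrightarrow> c = 0"
  shows "right_invertible y"
proof -
  have "(1 - y * G) * y \<in> socle" using y by (rule socle_mult_right)
  then have "y - y * G * y \<in> socle" by (simp add: left_diff_distrib)
  then obtain g where "y * g * y = y" using regular_mod_socle[OF sp] by blast
  then have "(1 - y * g) * y = 0" by (simp add: left_diff_distrib)
  then have "1 - y * g = 0" by (rule ann)
  then show ?thesis unfolding right_invertible_def by (metis eq_iff_diff_eq_0)
qed

text \<open>A telescoping product: the sum is the truncated Neumann series of (z - a)^(-1).\<close>

lemma shift_polar_sum:
  fixes a :: "'a::complex_unital_banach_algebra"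
  assumes "z \<noteq> 0"
  shows "shift a z * (\<Sum>j<k. scaleC (inverse z ^ Suc j) (a ^ j)) = scaleC (inverse z ^ k) (a ^ k) - 1"
proof (induction k)
  case (Suc k)
  have "shift a z * scaleC (inverse z ^ Suc k) (a ^ k) =
      scaleC (inverse z ^ Suc k) (a ^ Suc k) - scaleC (inverse z ^ k) (a ^ k)"
    using assms
    by (simp add: left_diff_distrib scaleC_mult_left scaleC_mult_right scaleC_scaleC scaleC.diff_right)
  then show ?case using Suc by (simp add: distrib_left)
qed (simp add: scaleC_one)

text \<open>Modulo the socle the idempotent a b splits the algebra. On its part \<open>b\<close>
  inverts \<open>a\<close>, so a - z has the inverse b (1 - z b)^(-1); on the part of
  \<open>p = 1 - a * b\<close> the element \<open>a\<close> is nilpotent, and the finite Neumann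
  series \<open>- H\<close> works. The poles of \<open>H\<close> are the reason for z \<noteq>
  0.\<close>

lemma shift_right_inverse_mod_socle:
  fixes a :: "'a::complex_unital_banach_algebra"
  assumes u: "a ^ k * (1 - a * b) \<in> socle" and v: "b - a * b * b \<in> socle"
    and z: "z \<noteq> 0" and r: "(1 - scaleC z b) * r = 1"
  shows "\<exists>G. 1 - shift a z * G \<in> socle"
proof
  define H where "H = (\<Sum>j<k. scaleC (inverse z ^ Suc j) (a ^ j))"
  define p where "p = 1 - a * b"
  have H: "shift a z * H = scaleC (inverse z ^ k) (a ^ k) - 1"
    unfolding H_def by (rule shift_polar_sum[OF z])
  have r1: "r - 1 = scaleC z b * r"
    using r by (simp add: left_diff_distrib diff_eq_eq eq_diff_eq add.commute)
  have "shift a z * b * r = (1 - scaleC z b) * r - p * r"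
    by (simp add: p_def algebra_simps scaleC_mult_left)
  then have br: "shift a z * b * r = 1 - p * r" using r by simp
  have "1 - shift a z * (b * r - H * p) = 1 - shift a z * b * r + shift a z * H * p"
    by (simp add: right_diff_distrib mult.assoc)
  also have "\<dots> = p * (r - 1) + scaleC (inverse z ^ k) (a ^ k) * p"
    unfolding br H by (simp add: algebra_simps)
  also have "\<dots> = scaleC z ((b - a * b * b) * r) + scaleC (inverse z ^ k) (a ^ k * (1 - a * b))"
    unfolding r1 by (simp add: p_def scaleC_mult_left scaleC_mult_right left_diff_distrib mult.assoc)
  finally show "1 - shift a z * (b * r - H * p) \<in> socle"
    using socle_add[OF socle_scaleC[OF socle_mult_right[OF v]] socle_scaleC[OF u]] by simp
qed

text \<open>A holomorphic kernel function \<open>f\<close> of \<open>r z * shift a z\<close> gives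
  \<open>g = f r\<close>, which a - z annihilates. The SVEP makes \<open>g\<close> zero, and so
  \<open>f = g (1 - z b)\<close> is zero; only the lower bound remains.\<close>

lemma sandwich_estimate:
  fixes a :: "'a::complex_unital_banach_algebra"
  assumes sp: "semiprime TYPE('a)" and u: "u \<in> socle" and svep: "right_SVEP_at a 0"
    and \<epsilon>: "0 < \<epsilon>" and r: "algebra_holomorphic_on r (ball 0 \<epsilon>)"
    and inv: "\<And>z. z \<in> ball 0 \<epsilon> \<Longrightarrow> r z * (1 - scaleC z b) = 1"
  obtains m C where "0 \<le> C" "eventually (\<lambda>z. \<forall>s. cmod z ^ m * norm (u * s * u) \<le>
    C * norm (u * s * u * (r z * shift a z))) (at 0)"
proof -
  let ?D = "ball (0::complex) \<epsilon>"
  obtain T where T: "finite T" "\<And>s. u * s * u \<in> CV.span T"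
    using socle_sandwich_finite_dim[OF sp u u] by blast
  define P where "P z = r z * shift a z" for z
  have hol: "algebra_holomorphic_on P ?D"
    unfolding P_def
    by (intro algebra_holomorphic_on_mult algebra_holomorphic_on_diff algebra_holomorphic_on_const
        algebra_holomorphic_on_scaleC r holomorphic_intros)
  have D: "open ?D" "connected ?D" "0 \<in> ?D" using \<epsilon> by auto
  have "{u * s * u | s. True} \<subseteq> CV.span T" using T(2) by blast
  from holomorphic_kernel_or_estimate[OF hol D this T(1)] consider
    (rel) f where "algebra_holomorphic_on f ?D" "\<exists>z\<in>?D. f z \<noteq> 0" "\<forall>z\<in>?D. f z * P z = 0"
  | (est) m C where "0 \<le> C" "eventually (\<lambda>z. \<forall>w\<in>{u * s * u | s. True}.
      cmod z ^ m * norm w \<le> C * norm (w * P z)) (at 0)"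
    by blast
  then show thesis
  proof cases
    case rel
    define g where "g z = f z * r z" for z
    have "algebra_holomorphic_on g ?D"
      unfolding g_def using rel(1) r by (rule algebra_holomorphic_on_mult)
    moreover have "g z * (scaleC z 1 - a) = 0" if "z \<in> ?D" for z
    proof -
      have "g z * (scaleC z 1 - a) = - (f z * P z)"
        by (simp add: g_def P_def right_diff_distrib mult.assoc)
      then show ?thesis using rel(3) that by simp
    qed
    ultimately have "g z = 0" if "z \<in> ?D" for z
      using svep D that unfolding right_SVEP_at_def by blast
    moreover obtain z where z: "z \<in> ?D" "f z \<noteq> 0" using rel(2) by blast
    moreover have "g z * (1 - scaleC z b) = f z"
      using inv[OF z(1)] by (simp add: g_def mult.assoc)
    ultimately show ?thesis by (metis mult_zero_left)
  next
    case est
    from est(2) have "eventually (\<lambda>z. \<forall>s. cmod z ^ m * norm (u * s * u) \<le>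
        C * norm (u * s * u * (r z * shift a z))) (at 0)"
      by eventually_elim (auto simp: P_def)
    then show ?thesis using est(1) that by blast
  qed
qed

text \<open>
  An element \<open>c\<close> annihilated by \<open>a - z\<close> satisfies \<open>c u = z^k c (1 - z b)\<close>; so \<open>u s c u\<close> lies in the
  finite-dimensional space \<open>u A u\<close> and is killed by \<open>r z (a - z)\<close>.
\<close>

lemma left_annihilator_trivial:
  fixes a :: "'a::complex_unital_banach_algebra"
  assumes sp: "semiprime TYPE('a)" and z: "z \<noteq> 0"
    and inv: "(1 - scaleC z b) * r = 1"
    and est: "\<forall>s. cmod z ^ m * norm (u * s * u) \<le> C * norm (u * s * u * (r * shift a z))"
    and u: "u = a ^ k * (1 - a * b)" and c: "c * shift a z = 0"
  shows "c = 0"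
proof (rule ccontr)
  assume "c \<noteq> 0"
  have ca: "c * a = scaleC z c" using c by (simp add: right_diff_distrib scaleC_mult_right)
  have can: "c * a ^ n = scaleC (z ^ n) c" for n
  proof (induction n)
    case (Suc n)
    have "c * a ^ Suc n = c * a ^ n * a" by (simp add: mult.assoc power_commutes)
    then show ?case by (simp add: Suc ca scaleC_mult_left scaleC_scaleC mult.commute)
  qed (simp add: scaleC_one)
  have cu: "c * u = scaleC (z ^ k) (c * (1 - scaleC z b))"
  proof -
    have "c * u = scaleC (z ^ k) (c * (1 - a * b))"
      unfolding u by (simp add: can scaleC_mult_left flip: mult.assoc)
    also have "c * (1 - a * b) = c * (1 - scaleC z b)"
      by (simp add: right_diff_distrib ca scaleC_mult_left scaleC_mult_right flip: mult.assoc)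
    finally show ?thesis .
  qed
  have "c * u \<noteq> 0"
  proof
    assume "c * u = 0"
    then have "c * (1 - scaleC z b) = 0" using cu z by (simp add: CV.scale_eq_0_iff)
    then have "c * ((1 - scaleC z b) * r) = 0" by (simp flip: mult.assoc)
    then show False using inv \<open>c \<noteq> 0\<close> by simp
  qed
  \<comment> \<open>Semiprimeness for \<open>c * u\<close> puts u (s c) u into the sandwich without
    losing it.\<close>
  then obtain s where "c * u * s * (c * u) \<noteq> 0"
    using semiprime_elementwise[OF sp] by blast
  then have ne: "u * (s * c) * u \<noteq> 0" by (metis mult.assoc mult_zero_right)
  have "u * (s * c) * u * (r * shift a z) = u * s * (c * u) * (r * shift a z)"
    by (simp add: mult.assoc)
  also have "\<dots> = scaleC (z ^ k) (u * s * (c * ((1 - scaleC z b) * r) * shift a z))"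
    unfolding cu by (simp add: scaleC_mult_left scaleC_mult_right mult.assoc)
  also have "\<dots> = 0" unfolding inv by (simp add: c scaleC.zero_right)
  finally have "cmod z ^ m * norm (u * (s * c) * u) \<le> 0"
    using est[rule_format, of "s * c"] by simp
  moreover have "0 < cmod z ^ m * norm (u * (s * c) * u)"
    using ne z by (intro mult_pos_pos) auto
  ultimately show False by simp
qed

text \<open>The factorization of a^(m+1) - z^(m+1) by a - z, multiplied by \<open>c\<close> on the
  left; free of division, it also holds at z = 0.\<close>

lemma geometric_sum_shift:
  fixes a c :: "'a::complex_unital_banach_algebra"
  shows "(\<Sum>i\<le>m. scaleC (z ^ i) (c * a ^ (m - i))) * a =
    scaleC z (\<Sum>i\<le>m. scaleC (z ^ i) (c * a ^ (m - i))) + c * a ^ Suc m - scaleC (z ^ Suc m) c"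
proof (induction m)
  case (Suc m)
  define S where "S m = (\<Sum>i\<le>m. scaleC (z ^ i) (c * a ^ (m - i)))" for m
  have rec: "S (Suc m) = S m * a + scaleC (z ^ Suc m) c"
  proof -
    have "scaleC (z ^ i) (c * a ^ (Suc m - i)) = scaleC (z ^ i) (c * a ^ (m - i)) * a" if "i \<le> m" for i
      using that by (simp add: Suc_diff_le scaleC_mult_left mult.assoc power_commutes)
    then show ?thesis by (simp add: S_def sum_distrib_right)
  qed
  have IH: "S m * a = scaleC z (S m) + c * a ^ Suc m - scaleC (z ^ Suc m) c"
    using Suc by (simp add: S_def)
  have "S (Suc m) * a = (S m * a) * a + scaleC (z ^ Suc m) (c * a)"
    by (simp add: rec distrib_right scaleC_mult_left)
  also have "\<dots> = scaleC z (S m * a) + c * a ^ Suc (Suc m)"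
    by (subst IH) (simp add: distrib_right left_diff_distrib scaleC_mult_left mult.assoc power_commutes)
  also have "\<dots> = scaleC z (S (Suc m)) + c * a ^ Suc (Suc m) - scaleC (z ^ Suc (Suc m)) c"
    by (simp add: rec scaleC_add_right scaleC_scaleC)
  finally show ?case by (simp only: S_def)
qed (simp add: scaleC_one)

text \<open>
  If \<open>c a^(n+1) = 0 \<noteq> c a^n\<close>, then \<open>\<Sum>i\<le>m. z^i c a^(m-i) u\<close> is a nonvanishing solution of the kernel
  equation up to an error of order \<open>z^(m+1)\<close>, too small for the estimate with exponent \<open>m\<close>.
\<close>

lemma left_annihilator_stationary:
  fixes a :: "'a::complex_unital_banach_algebra"
  assumes sp: "semiprime TYPE('a)" and \<epsilon>: "0 < \<epsilon>"
    and r: "algebra_holomorphic_on r (ball 0 \<epsilon>)"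
    and inv: "\<And>z. z \<in> ball 0 \<epsilon> \<Longrightarrow> (1 - scaleC z b) * r z = 1"
    and est: "0 \<le> C" "eventually (\<lambda>z. \<forall>s. cmod z ^ m * norm (u * s * u) \<le>
      C * norm (u * s * u * (r z * shift a z))) (at 0)"
    and u: "u = a ^ k * (1 - a * b)" and c: "c * a ^ Suc (m + k) = 0"
  shows "c * a ^ (m + k) = 0"
proof (rule ccontr)
  assume ne: "c * a ^ (m + k) \<noteq> 0"
  have "c * a ^ m * u = c * a ^ (m + k) - c * a ^ Suc (m + k) * b"
    by (simp add: u right_diff_distrib mult.assoc power_add power_commutes)
       (simp add: power_commutes flip: mult.assoc)
  then have cu: "c * a ^ m * u = c * a ^ (m + k)" using c by simp
  then obtain s where "c * a ^ m * u * s * (c * a ^ m * u) \<noteq> 0"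
    using ne semiprime_elementwise[OF sp] by metis
  then have d0: "u * (s * c * a ^ m) * u \<noteq> 0" by (metis mult.assoc mult_zero_right)
  \<comment> \<open>The left factor \<open>u\<close> in \<open>d\<close> puts \<open>S z * u\<close>
    into u A u, where the estimate applies.\<close>
  define d where "d = u * (s * c)"
  have dz: "d * a ^ Suc (m + k) = 0" using c by (simp add: d_def mult.assoc)
  define S' where "S' z = (\<Sum>i\<le>m. scaleC (z ^ i) (s * c * a ^ (m - i)))" for z
  define S where "S z = (\<Sum>i\<le>m. scaleC (z ^ i) (d * a ^ (m - i)))" for z
  have S: "S z = u * S' z" for z
    by (simp add: S_def S'_def d_def sum_distrib_left scaleC_mult_right mult.assoc)
  define P where "P z = r z * shift a z" for z
  define E where "E z = d * a ^ k * b * P z - d * a ^ k" for z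
  \<comment> \<open>Because d a^(m+k+1) = 0, the product g (a - z) is pure error. Multiplying
    \<open>g\<close> by 1 - a b gives g (1 - z b) plus an error of the same order, and the factor
    \<open>r z\<close> of \<open>P z\<close> cancels 1 - z b.\<close>
  have key: "u * S' z * u * P z = scaleC (z ^ Suc m) (E z)" if z: "z \<in> ball 0 \<epsilon>" for z
  proof -
    define g where "g = S z * a ^ k"
    have "g * a = S z * a * a ^ k" by (simp add: g_def mult.assoc power_commutes)
    also have "S z * a = scaleC z (S z) + d * a ^ Suc m - scaleC (z ^ Suc m) d"
      unfolding S_def by (rule geometric_sum_shift)
    also have "\<dots> * a ^ k = scaleC z g + d * a ^ Suc (m + k) - scaleC (z ^ Suc m) (d * a ^ k)"
      by (simp add: g_def distrib_right left_diff_distrib scaleC_mult_left mult.assoc power_add)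
    finally have ga: "g * a = scaleC z g - scaleC (z ^ Suc m) (d * a ^ k)" using dz by simp
    have "u * S' z * u = g - g * a * b"
      unfolding S[symmetric] by (simp add: u g_def right_diff_distrib mult.assoc)
    also have "\<dots> = g * (1 - scaleC z b) + scaleC (z ^ Suc m) (d * a ^ k * b)"
      unfolding ga by (simp add: left_diff_distrib right_diff_distrib scaleC_mult_left scaleC_mult_right)
    finally have "u * S' z * u * P z =
        g * ((1 - scaleC z b) * r z) * shift a z + scaleC (z ^ Suc m) (d * a ^ k * b * P z)"
      by (simp add: distrib_right scaleC_mult_left P_def mult.assoc)
    also have "g * ((1 - scaleC z b) * r z) * shift a z = - scaleC (z ^ Suc m) (d * a ^ k)"
      using ga by (simp add: inv[OF z] right_diff_distrib scaleC_mult_right)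
    finally show ?thesis by (simp add: E_def scaleC.diff_right)
  qed
  have hol: "algebra_holomorphic_on (\<lambda>z. u * S' z * u) UNIV" "algebra_holomorphic_on E (ball 0 \<epsilon>)"
    unfolding S'_def E_def P_def
    by (intro algebra_holomorphic_on_mult algebra_holomorphic_on_diff algebra_holomorphic_on_const
        algebra_holomorphic_on_sum algebra_holomorphic_on_scaleC r holomorphic_intros)+
  have "isCont (\<lambda>z. u * S' z * u) 0" "isCont E 0"
    using algebra_holomorphic_on_continuous[OF hol(1)] algebra_holomorphic_on_continuous[OF hol(2)] \<epsilon>
    by auto
  then have lim: "((\<lambda>z. norm (u * S' z * u)) \<longlongrightarrow> norm (u * S' 0 * u)) (at 0)"
    "((\<lambda>z. C * cmod z * norm (E z)) \<longlongrightarrow> C * cmod 0 * norm (E 0)) (at 0)"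
    unfolding isCont_def by (auto simp only: intro!: tendsto_norm tendsto_mult tendsto_const tendsto_ident_at)
  have "eventually (\<lambda>z. z \<in> ball 0 \<epsilon>) (at 0)"
    using \<epsilon> by (intro eventually_at_in_open') auto
  with est(2) eventually_neq_at_within[of 0]
  have "eventually (\<lambda>z. norm (u * S' z * u) \<le> C * cmod z * norm (E z)) (at 0)"
  proof eventually_elim
    case (elim z)
    \<comment> \<open>After cancelling |z|^m one factor |z| is left on the right, so the bound tends
      to 0. On the left only the term i = 0 of \<open>S'\<close> survives in the limit.\<close>
    have "cmod z ^ m * norm (u * S' z * u) \<le> C * norm (u * S' z * u * P z)"
      using elim(1) by (simp add: P_def)
    also have "\<dots> = cmod z ^ m * (C * cmod z * norm (E z))"
      by (simp add: key[OF elim(3)] norm_scaleC norm_power norm_mult)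
    finally show ?case using elim(2) by simp
  qed
  then have "norm (u * S' 0 * u) \<le> C * cmod 0 * norm (E 0)"
    using lim by (intro tendsto_le[OF at_neq_bot lim(2) lim(1)])
  then have "u * S' 0 * u = 0" by simp
  moreover have "S' 0 = s * c * a ^ m"
  proof -
    have "S' 0 = (\<Sum>i\<in>{0}. scaleC (0 ^ i) (s * c * a ^ (m - i)))"
      unfolding S'_def by (rule sum.mono_neutral_right) (auto simp: scaleC.zero_left power_0_left)
    then show ?thesis by (simp add: scaleC_one)
  qed
  ultimately show False using d0 by simp
qed

lemma q_l_finite_iff:
  "q_l x < \<infinity> \<longleftrightarrow> (\<exists>n. range (\<lambda>a. x ^ n * a) = range (\<lambda>a. x ^ Suc n * a))"
proof
  assume "\<exists>n. range (\<lambda>a. x ^ n * a) = range (\<lambda>a. x ^ Suc n * a)"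
  then obtain n where n: "range (\<lambda>a. x ^ n * a) = range (\<lambda>a. x ^ Suc n * a)" by blast
  have "q_l x \<le> enat n" unfolding q_l_def by (rule INF_lower) (use n in blast)
  then show "q_l x < \<infinity>" by (rule order.strict_trans1) simp
next
  assume fin: "q_l x < \<infinity>"
  show "\<exists>n. range (\<lambda>a. x ^ n * a) = range (\<lambda>a. x ^ Suc n * a)"
  proof (rule ccontr)
    assume "\<nexists>n. range (\<lambda>a. x ^ n * a) = range (\<lambda>a. x ^ Suc n * a)"
    then have "{n. range (\<lambda>a. x ^ n * a) = range (\<lambda>a. x ^ Suc n * a)} = {}" by blast
    then have "q_l x = \<infinity>" unfolding q_l_def by (simp only: image_empty Inf_empty top_enat_def)
    then show False using fin by simp
  qed
qed

lemma B_Fredholm_SVEP_zero: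
  fixes a :: "'a::complex_unital_banach_algebra"
  assumes sp: "semiprime TYPE('a)" and bf: "B_Fredholm a" and svep: "right_SVEP_at a 0"
  shows "eventually (\<lambda>z. right_invertible (shift a z)) (at 0)" "q_l a < \<infinity>"
proof -
  obtain b k where bk: "a ^ k * (1 - a * b) \<in> socle" "b - a * b * b \<in> socle"
    and reg: "\<And>m. k < m \<Longrightarrow> a ^ m - a ^ m * b ^ m * a ^ m \<in> socle"
    by (rule B_Fredholm_drazin_data[OF bf]) (rule that)
  obtain r \<epsilon> where r: "0 < \<epsilon>" "algebra_holomorphic_on r (ball 0 \<epsilon>)"
    "\<And>z. z \<in> ball 0 \<epsilon> \<Longrightarrow> (1 - scaleC z b) * r z = 1"
    "\<And>z. z \<in> ball 0 \<epsilon> \<Longrightarrow> r z * (1 - scaleC z b) = 1"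
    by (rule inverse_resolvent[of b]) (rule that)
  define u where "u = a ^ k * (1 - a * b)"
  obtain m C where est: "0 \<le> C" "eventually (\<lambda>z. \<forall>s. cmod z ^ m * norm (u * s * u) \<le>
      C * norm (u * s * u * (r z * shift a z))) (at 0)"
    by (rule sandwich_estimate[OF sp bk(1)[folded u_def] svep r(1,2,4)]) (assumption, rule that)
  have "eventually (\<lambda>z. z \<in> ball 0 \<epsilon>) (at 0)"
    using r(1) by (intro eventually_at_in_open') auto
  with est(2) eventually_neq_at_within[of 0]
  show "eventually (\<lambda>z. right_invertible (shift a z)) (at 0)"
  proof eventually_elim
    case (elim z)
    obtain G where "1 - shift a z * G \<in> socle"
      using shift_right_inverse_mod_socle[OF bk elim(2) r(3)[OF elim(3)]] by blast
    then show ?case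
      using left_annihilator_trivial[OF sp elim(2) r(3)[OF elim(3)] elim(1) u_def]
      by (rule regular_right_inverse[OF sp])
  qed
  \<comment> \<open>At this index the left annihilators of the powers stop growing, and
    \<open>Suc n\<close> exceeds \<open>k\<close>, as \<open>reg\<close> demands. An element of the
    form \<open>1 - a ^ Suc n * g\<close> that kills \<open>a ^ Suc n\<close> therefore kills
    \<open>a ^ n\<close>.\<close>
  define n where "n = m + k"
  have "a ^ Suc n - a ^ Suc n * b ^ Suc n * a ^ Suc n \<in> socle" by (rule reg) (simp add: n_def)
  then obtain g where g: "a ^ Suc n * g * a ^ Suc n = a ^ Suc n"
    using regular_mod_socle[OF sp] by blast
  have "(1 - a ^ Suc n * g) * a ^ Suc n = 0" unfolding left_diff_distrib g by simp
  then have "(1 - a ^ Suc n * g) * a ^ n = 0"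
    using left_annihilator_stationary[OF sp r(1,2,3) est u_def] unfolding n_def by blast
  then have an: "a ^ n = a ^ Suc n * (g * a ^ n)"
    by (simp add: left_diff_distrib mult.assoc)
  have "range (\<lambda>x. a ^ n * x) = range (\<lambda>x. a ^ Suc n * x)"
  proof
    have "a ^ n * x = a ^ Suc n * (g * a ^ n * x)" for x
      using arg_cong[OF an, of "\<lambda>y. y * x"] by (simp only: mult.assoc)
    then show "range (\<lambda>x. a ^ n * x) \<subseteq> range (\<lambda>x. a ^ Suc n * x)" by (metis image_subsetI rangeI)
    have "a ^ Suc n * x = a ^ n * (a * x)" for x by (simp add: mult.assoc power_commutes flip: mult.assoc)
    then show "range (\<lambda>x. a ^ Suc n * x) \<subseteq> range (\<lambda>x. a ^ n * x)" by (metis image_subsetI rangeI)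
  qed
  then show "q_l a < \<infinity>" unfolding q_l_finite_iff by blast
qed

section \<open>The alternative\<close>

lemma shift_shift: "shift (shift x z) w = shift x (z + w)"
  by (simp add: scaleC_add_left)

lemma right_SVEP_at_shift:
  fixes x :: "'a::complex_unital_banach_algebra"
  assumes "right_SVEP_at x z"
  shows "right_SVEP_at (shift x z) 0"
  unfolding right_SVEP_at_def
proof (intro allI impI, elim conjE)
  fix U f assume U: "open U" "connected U" "0 \<in> U" and f: "algebra_holomorphic_on f U"
    and f0: "\<forall>w\<in>U. f w * (scaleC w 1 - shift x z) = (0::'a)"
  define V where "V = (+) z ` U"
  define g where "g y = f (y - z)" for y
  have V: "open V" "connected V" "z \<in> V"
    using U by (auto simp: V_def open_translation image_iff
      intro!: connected_continuous_image continuous_intros)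
  have "algebra_holomorphic_on g V"
    unfolding algebra_holomorphic_on_def
  proof
    fix y assume "y \<in> V"
    then have y: "y - z \<in> U" by (auto simp: V_def)
    then obtain D where "(f has_derivative (\<lambda>h. scaleC h D)) (at (y - z) within U)"
      using f unfolding algebra_holomorphic_on_def by blast
    then have "(f has_derivative (\<lambda>h. scaleC h D)) (at (y - z))"
      using at_within_open[OF y U(1)] by simp
    moreover have "((\<lambda>y. y - z) has_derivative (\<lambda>h. h)) (at y within V)"
      by (auto intro!: derivative_eq_intros)
    ultimately have "((\<lambda>y. f (y - z)) has_derivative (\<lambda>h. scaleC h D)) (at y within V)"
      by (rule has_derivative_compose[rotated])
    then show "\<exists>D. (g has_derivative (\<lambda>h. scaleC h D)) (at y within V)"
      unfolding g_def by blast
  qed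
  moreover have "g y * (scaleC y 1 - x) = 0" if "y \<in> V" for y
  proof -
    have "f (y - z) * (scaleC (y - z) 1 - shift x z) = 0" using f0 that by (auto simp: V_def)
    then show ?thesis by (simp add: g_def scaleC.diff_left)
  qed
  ultimately have "g y = 0" if "y \<in> V" for y
    using assms V that unfolding right_SVEP_at_def by blast
  then show "\<forall>w\<in>U. f w = 0" unfolding g_def V_def by force
qed

lemma B_Fredholm_SVEP:
  fixes x :: "'a::complex_unital_banach_algebra"
  assumes "semiprime TYPE('a)" "B_Fredholm (shift x z)" "right_SVEP_at x z"
  shows "eventually (\<lambda>w. right_invertible (shift x w)) (at z)" "q_l (shift x z) < \<infinity>"
proof -
  note * = B_Fredholm_SVEP_zero[OF assms(1,2) right_SVEP_at_shift[OF assms(3)]]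
  show "q_l (shift x z) < \<infinity>" by (rule *(2))
  show "eventually (\<lambda>w. right_invertible (shift x w)) (at z)"
    using *(1) unfolding shift_shift eventually_at_to_0[of _ z] by (simp add: add.commute)
qed

text \<open>A right invertible element has no left annihilator, so \<open>f\<close> vanishes on a
  punctured disc around \<open>z\<close>, hence on all of the connected set \<open>U\<close>.
  Together with \<open>B_Fredholm_SVEP\<close> this characterizes the SVEP at B-Fredholm points and
  shows that it spreads to nearby points.\<close>

lemma right_SVEP_at_if_right_invertible:
  fixes x :: "'a::complex_unital_banach_algebra"
  assumes "eventually (\<lambda>w. right_invertible (shift x w)) (at z)"
  shows "right_SVEP_at x z"
  unfolding right_SVEP_at_def
proof (intro allI impI ballI, elim conjE)
  fix U f w assume U: "open U" "connected U" "z \<in> U" and f: "algebra_holomorphic_on f U"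
    and f0: "\<forall>w\<in>U. f w * (scaleC w 1 - x) = (0::'a)" and w: "w \<in> U"
  have "eventually (\<lambda>w. w \<in> U \<and> right_invertible (shift x w)) (at z)"
    using assms eventually_at_in_open'[OF U(1,3)] by eventually_elim simp
  then obtain d where d: "0 < d"
    "\<And>w. w \<noteq> z \<Longrightarrow> dist w z < d \<Longrightarrow> w \<in> U \<and> right_invertible (shift x w)"
    unfolding eventually_at by blast
  have "z islimpt ball z d" using d(1) by (intro interior_limit_point) simp
  then have "z islimpt (ball z d - {z})" by (simp flip: islimpt_punctured)
  moreover have dU: "y \<in> U \<and> right_invertible (shift x y)" if "y \<in> ball z d - {z}" for y
    using that by (intro d(2)) (auto simp: dist_commute)
  then have "ball z d - {z} \<subseteq> U" by blast
  moreover have "f y = 0" if "y \<in> ball z d - {z}" for y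
  proof -
    have y: "y \<in> U" "right_invertible (shift x y)" using dU that by auto
    then obtain g where g: "shift x y * g = 1" unfolding right_invertible_def by blast
    have "f y * shift x y = - (f y * (scaleC y 1 - x))" by (simp add: right_diff_distrib)
    then have "f y * shift x y * g = 0" using f0 y(1) by simp
    then show ?thesis using g by (simp add: mult.assoc)
  qed
  ultimately show "f w = 0"
    using algebra_analytic_continuation[OF f U] w by blast
qed

text \<open>Where the witness is nonzero, \<open>f y\<close> is a left eigenvector of
  \<open>shift x z\<close> with eigenvalue y - z. By the identity theorem this happens for y
  \<noteq> z arbitrarily close to \<open>z\<close>; normalized, these eigenvectors give the sequence
  of the topological divisor of zero.\<close>

lemma not_right_SVEP_at:
  fixes x :: "'a::complex_unital_banach_algebra"
  assumes "\<not> right_SVEP_at x z"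
  shows "q_l (shift x z) = \<infinity>" "right_topological_zero_divisor (shift x z)"
proof -
  obtain U f w0 where U: "open U" "connected U" "z \<in> U" and f: "algebra_holomorphic_on f U"
    and f0: "\<forall>w\<in>U. f w * (scaleC w 1 - x) = (0::'a)" and w0: "w0 \<in> U" "f w0 \<noteq> 0"
    using assms unfolding right_SVEP_at_def by blast
  have ex: "\<exists>t h. t \<noteq> 0 \<and> cmod t < d \<and> h \<noteq> 0 \<and> h * shift x z = scaleC t h" if d: "0 < d" for d
  proof -
    have "\<exists>y\<in>U \<inter> ball z d - {z}. f y \<noteq> 0"
    proof (rule ccontr)
      assume "\<not> (\<exists>y\<in>U \<inter> ball z d - {z}. f y \<noteq> 0)"
      moreover have "z islimpt (U \<inter> ball z d)"
        using U d by (intro interior_limit_point) (simp add: interior_open)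
      then have "z islimpt (U \<inter> ball z d - {z})" by (simp flip: islimpt_punctured)
      ultimately show False
        using algebra_analytic_continuation[OF f U, of "U \<inter> ball z d - {z}" w0] w0 by blast
    qed
    then obtain y where y: "y \<in> U" "y \<in> ball z d" "y \<noteq> z" "f y \<noteq> 0" by blast
    have "f y * shift x z = scaleC (y - z) (f y) - f y * (scaleC y 1 - x)"
      by (simp add: right_diff_distrib scaleC_mult_right scaleC.diff_left)
    then have "f y * shift x z = scaleC (y - z) (f y)" using f0 y(1) by simp
    then show ?thesis
      using y by (intro exI[of _ "y - z"] exI[of _ "f y"]) (auto simp: dist_norm norm_minus_commute)
  qed
  show "right_topological_zero_divisor (shift x z)"
  proof -
    have "\<forall>n. \<exists>s. norm s = 1 \<and> norm (s * shift x z) \<le> inverse (real (Suc n))"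
    proof
      fix n
      obtain t h where th: "cmod t < inverse (real (Suc n))" "h \<noteq> 0" "h * shift x z = scaleC t h"
        using ex[of "inverse (real (Suc n))"] by auto
      have "(inverse (norm h) *\<^sub>R h) * shift x z = scaleC t (inverse (norm h) *\<^sub>R h)"
        by (simp add: th scaleR_eq_scaleC scaleC_scaleC mult.commute del: mult_scaleR_left)
          (simp add: th scaleC_mult_left scaleC_scaleC mult.commute)
      then show "\<exists>s. norm s = 1 \<and> norm (s * shift x z) \<le> inverse (real (Suc n))"
        using th by (intro exI[of _ "inverse (norm h) *\<^sub>R h"]) (simp add: norm_scaleC)
    qed
    from choice[OF this] obtain s
      where s: "\<And>n. norm (s n) = 1" "\<And>n. norm (s n * shift x z) \<le> inverse (real (Suc n))"
      by blast
    have "(\<lambda>n. s n * shift x z) \<longlonglongrightarrow> 0"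
      using s(2) by (intro Lim_null_comparison[OF _ LIMSEQ_inverse_real_of_nat]) auto
    then show ?thesis using s(1) unfolding right_topological_zero_divisor_def by blast
  qed
  show "q_l (shift x z) = \<infinity>"
  proof (rule ccontr)
    define a where "a = shift x z"
    assume "q_l (shift x z) \<noteq> \<infinity>"
    then obtain n where "range (\<lambda>y. a ^ n * y) = range (\<lambda>y. a ^ Suc n * y)"
      using q_l_finite_iff[of a] by (auto simp: a_def)
    then obtain c where "a ^ n * 1 = a ^ Suc n * c" by (metis rangeE rangeI)
    then have c: "a ^ n = a ^ Suc n * c" by simp
    \<comment> \<open>Combining a^n = a^(n+1) c with h a = t h gives t^n h = t^(n+1) h c. As t
      \<noteq> 0, t^n cancels, and the bound on t makes 1 - t c invertible, so h = 0.\<close>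
    obtain t h where th: "t \<noteq> 0" "cmod t < inverse (norm c + 1)" "h \<noteq> 0" "h * a = scaleC t h"
      using ex[of "inverse (norm c + 1)"] by (auto simp: a_def add_nonneg_pos)
    have ha: "h * a ^ j = scaleC (t ^ j) h" for j
    proof (induction j)
      case (Suc j)
      have "h * a ^ Suc j = h * a ^ j * a" by (simp add: mult.assoc power_commutes)
      then show ?case by (simp add: Suc th scaleC_mult_left scaleC_scaleC mult.commute)
    qed (simp add: scaleC_one)
    have "scaleC (t ^ n) h = h * a ^ Suc n * c" using c ha[of n] by (simp add: mult.assoc)
    also have "\<dots> = scaleC (t ^ n) (h * scaleC t c)"
      unfolding ha by (simp add: scaleC_mult_left scaleC_mult_right scaleC_scaleC mult.commute)
    finally have "h = h * scaleC t c" using th(1) by (simp add: CV.scale_left_imp_eq)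
    then have "h * (1 - scaleC t c) = 0" by (simp add: right_diff_distrib)
    moreover have "norm (scaleC t c) < 1"
    proof -
      have "cmod t * (norm c + 1) < 1"
        using th(2) by (simp add: inverse_eq_divide pos_less_divide_eq add_nonneg_pos)
      then show ?thesis using norm_ge_zero[of t] unfolding norm_scaleC distrib_left by linarith
    qed
    then obtain r where "(1 - scaleC t c) * r = 1" using neumann_series by blast
    ultimately have "h = 0" by (metis mult.assoc mult.right_neutral mult_zero_left)
    then show False using th by simp
  qed
qed

lemma right_invertible_not_zero_divisor:
  fixes a :: "'a::complex_unital_banach_algebra"
  assumes "right_invertible a"
  shows "\<not> right_topological_zero_divisor a"
proof
  assume "right_topological_zero_divisor a"
  then obtain s :: "nat \<Rightarrow> 'a" where s: "\<And>n. norm (s n) = 1" "(\<lambda>n. s n * a) \<longlonglongrightarrow> 0"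
    unfolding right_topological_zero_divisor_def by blast
  obtain b where b: "a * b = 1" using assms unfolding right_invertible_def by blast
  have "(\<lambda>n. s n * a * b) \<longlonglongrightarrow> 0 * b" using s(2) by (intro tendsto_intros)
  then have "s \<longlonglongrightarrow> 0" by (simp add: mult.assoc b)
  then have "(\<lambda>n. norm (s n)) \<longlonglongrightarrow> 0" by (rule tendsto_norm_zero)
  then show False using s(1) by (simp add: LIMSEQ_const_iff)
qed

theorem theorem4p2:
  fixes x :: "'a::complex_unital_banach_algebra" and \<Omega> :: "complex set"
  assumes "semiprime TYPE('a)"
    and "(socle :: 'a set) \<noteq> {0}"
    and "\<Omega> \<in> components (rho_BF x)"
  shows "((\<forall>z\<in>\<Omega>. right_SVEP_at x z) \<and>
          (\<forall>z\<in>\<Omega>. q_l (shift x z) < \<infinity>) \<and>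
          (\<forall>z\<in>\<Omega>. \<not> z islimpt sigma_r x) \<and>
          (\<exists>E\<subseteq>\<Omega>. countable E \<and> (\<forall>z\<in>E. z isolated_in E) \<and>
             (\<forall>z\<in>\<Omega> - E. \<not> right_topological_zero_divisor (shift x z))))
       \<or> ((\<forall>z\<in>\<Omega>. \<not> right_SVEP_at x z) \<and>
          (\<forall>z\<in>\<Omega>. q_l (shift x z) = \<infinity>) \<and>
          (\<forall>z\<in>\<Omega>. right_topological_zero_divisor (shift x z)))"
proof -
  have \<Omega>: "connected \<Omega>" "\<And>z. z \<in> \<Omega> \<Longrightarrow> B_Fredholm (shift x z)"
    using in_components_connected[OF assms(3)] in_components_subset[OF assms(3)]
    by (auto simp: rho_BF_def sigma_BF_def)
  have inv: "eventually (\<lambda>w. right_invertible (shift x w)) (at z)"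
    if "z \<in> \<Omega>" "right_SVEP_at x z" for z
    using B_Fredholm_SVEP(1)[OF assms(1) \<Omega>(2)] that by blast
  define A where "A = interior {z. right_SVEP_at x z}"
  define B where "B = interior {z. \<not> right_SVEP_at x z}"
  have "z \<in> A" if z: "z \<in> \<Omega>" "right_SVEP_at x z" for z
  proof -
    obtain d where d: "0 < d" "\<And>w. w \<noteq> z \<Longrightarrow> dist w z < d \<Longrightarrow> right_invertible (shift x w)"
      using inv[OF z] unfolding eventually_at by blast
    have "right_SVEP_at x w" if w: "w \<in> ball z d" for w
    proof (cases "w = z")
      case False
      \<comment> \<open>Right invertibility may fail at \<open>z\<close> itself, but
        \<open>w\<close> has a neighbourhood that avoids \<open>z\<close>.\<close>
      have "eventually (\<lambda>y. y \<in> ball z d - {z}) (at w)"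
        using w False by (intro eventually_at_in_open') auto
      then have "eventually (\<lambda>y. right_invertible (shift x y)) (at w)"
        by eventually_elim (use d(2) in \<open>auto simp: dist_commute\<close>)
      then show ?thesis by (rule right_SVEP_at_if_right_invertible)
    qed (use z in simp)
    then show ?thesis
      unfolding A_def using d(1) by (intro interiorI[of "ball z d"]) auto
  qed
  \<comment> \<open>A function that refutes the SVEP at \<open>z\<close> refutes it at every point
    of its domain, so failure is an open condition in the whole plane.\<close>
  moreover have "z \<in> B" if z: "\<not> right_SVEP_at x z" for z
  proof -
    obtain U f w where "open U" "connected U" "z \<in> U" "algebra_holomorphic_on f U"
      "\<forall>w\<in>U. f w * (scaleC w 1 - x) = (0::'a)" "w \<in> U" "f w \<noteq> 0"
      using z unfolding right_SVEP_at_def by blast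
    then have "U \<subseteq> {z. \<not> right_SVEP_at x z}" unfolding right_SVEP_at_def by blast
    with \<open>open U\<close> \<open>z \<in> U\<close> show ?thesis unfolding B_def by (intro interiorI)
  qed
  ultimately have "\<Omega> \<subseteq> A \<union> B" by blast
  moreover have AB: "A \<subseteq> {z. right_SVEP_at x z}" "B \<subseteq> {z. \<not> right_SVEP_at x z}"
    unfolding A_def B_def by (auto dest: interior_subset[THEN subsetD])
  then have "A \<inter> B \<inter> \<Omega> = {}" by blast
  ultimately consider "A \<inter> \<Omega> = {}" | "B \<inter> \<Omega> = {}"
    using connectedD[OF \<Omega>(1), of A B] by (auto simp: A_def B_def)
  then show ?thesis
  proof cases
    case 1
    then have "\<forall>z\<in>\<Omega>. \<not> right_SVEP_at x z" using \<open>\<Omega> \<subseteq> A \<union> B\<close> AB by blast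
    then show ?thesis by (simp add: not_right_SVEP_at)
  next
    case 2
    then have svep: "\<forall>z\<in>\<Omega>. right_SVEP_at x z" using \<open>\<Omega> \<subseteq> A \<union> B\<close> AB by blast
    have lim: "\<not> z islimpt sigma_r x" if "z \<in> \<Omega>" for z
      using inv[of z] svep that
      by (auto simp: islimpt_iff_eventually sigma_r_def elim: eventually_mono)
    define E where "E = {z \<in> \<Omega>. right_topological_zero_divisor (shift x z)}"
    have E: "E \<subseteq> sigma_r x"
      unfolding E_def sigma_r_def using right_invertible_not_zero_divisor by blast
    \<comment> \<open>Limit points form a closed set, so \<open>W\<close> is an open set containing
      \<Omega>. In it \<open>sigma_r x\<close> is sparse, and a sparse set in an open set is
      countable.\<close>
    define W where "W = - {z. z islimpt sigma_r x}"
    have "open W" unfolding W_def using closed_limpts by (rule open_Compl)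
    then have "sigma_r x sparse_in W"
      unfolding sparse_in_def by (intro ballI exI[of _ W]) (simp add: W_def)
    then have "countable (W \<inter> sigma_r x)" using \<open>open W\<close> by (intro sparse_imp_countable)
    moreover have "E \<subseteq> W \<inter> sigma_r x" using E lim by (auto simp: W_def E_def)
    ultimately have "countable E" by (rule countable_subset[rotated])
    moreover have "z isolated_in E" if "z \<in> E" for z
      using that lim[of z] islimpt_subset[OF _ E] by (auto simp: isolated_in_islimpt_iff E_def)
    ultimately have "\<exists>E\<subseteq>\<Omega>. countable E \<and> (\<forall>z\<in>E. z isolated_in E) \<and>
        (\<forall>z\<in>\<Omega> - E. \<not> right_topological_zero_divisor (shift x z))"
      by (intro exI[of _ E]) (auto simp: E_def)
    then show ?thesis
      using svep lim B_Fredholm_SVEP(2)[OF assms(1) \<Omega>(2)] by (intro disjI1 conjI ballI) simp_all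
  qed
qed

end
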